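(* Let $k>1$ and let $G,H$ be simple undirected graphs with vertex set $V=\{1,\dots,n\}$. Then: (i) $\mathcal Q^{k+1}_G=\{\mathcal I_n\}$ (where $\mathcal I_n$ is the $n\times n$ identity matrix) if and only if the $k$-dimensional Weisfeiler-Lehman (W-L) algorithm determines that $G$ is asymmetric; (ii) $\mathcal Q^{k+1}_{G,H}=\emptyset$ if and only if the $k$-dimensional W-L algorithm determines that $G$ and $H$ are not isomorphic.
   Context: **The semi-algebraic set.** $E_G$ is the edge set of $G$ and $e$ the all-ones vector. $\mathcal Q_{G,H}$ is the set of $X\in[0,1]^{n\times n}$ with $Xe=X^Te=e$, $X_{u_1v_1}X_{u_2v_2}=0$ for all $\{u_1,u_2\}\in E_G,\{v_1,v_2\}\notin E_H$, and $X_{u_1v_1}X_{u_2v_2}=0$ for all $\{u_1,u_2\}\notin E_G$, $\{v_1,v_2\}\in E_H$ (here $u_1=u_2$ counts as $\{u_1,u_2\}\notin E_G$, and $v_1=v_2$ as $\{v_1,v_2\}\notin E_H$). $\mathcal Q_G=\mathcal Q_{G,G}$. **Sherali-Adams relaxations.** For $P=\{x\in[0,1]^N: f_j(x)=0\ (1\le j\le s),\ g_j(x)\ge 0\ (1\le j\le t)\}$ with polynomials $f_j,g_j$, the $k$th Sherali-Adams relaxation $P^k$ is obtained as follows. Form the constraints $\prod_{i\in I}x_i\, f_j(x)=0$ for all $I\subseteq\{1,\dots,N\}$, $|I|\le k-1$ and all $j$; $\prod_{i\in I}x_i\prod_{i\in J\setminus I}(1-x_i)\,g_j(x)\ge0$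 for all $I\subseteq J$, $|J|\le k-1$ and all $j$; and $\prod_{i\in I}x_i\prod_{i\in J\setminus I}(1-x_i)\ge 0$ for all $I\subseteq J$, $|J|\le k$. Expand, replace every $x_i^2$ by $x_i$ repeatedly until all monomials are square-free, and replace each monomial $\prod_{i\in I}x_i$ with $|I|\ge 1$ by a new variable $y_I$ (and the empty monomial by $1$). This gives a polyhedron $\hat P^k$ in $y$-space, and $P^k=\{x: x_i=y_{\{i\}}\ \forall i,\ y\in\hat P^k\}$. $\mathcal Q^k_{G,H}$, $\mathcal Q^k_G$ are the $k$th relaxations of $\mathcal Q_{G,H}$, $\mathcal Q_G$, where the $f_j$ are the row-sum and column-sum equations and the displayed quadratic equations, and there are no $g_j$. **Tuples.** For $u\in V^k$, $w\in V$, $1\le i\le k$, $\phi_i(u,w)$ is $u$ with its $i$th entry replaced by $w$. $\vec{\mathcal C}_G(u)$ is the $k\times k$ matrix with $(i,j)$ entry $0$ if $u_i=u_j$, $1$ if $\{u_i,u_j\}\in E_G$, and $-1$ otherwise. **$k$-dim W-L algorithm, automorphism version.** Start with the partition of $V^k$ in which $u,v$ are equivalent iff $\vec{\mathcal C}_G(u)=\vec{\mathcal C}_G(v)$. Given a partition $\pi$, refine it to the partition in which $u,v$ are equivalent iff $u\equiv_\pi v$ and there is a bijection $\psi:V\to V$ with $\phi_i(u,w)\equiv_\pi\phi_i(v,\psi(w))$ for all $1\le i\le k$ and all $w\in V$. Iterate until the partition stabilises. The algorithm determines that $G$ is asymmetric iff the final partition is complete (all cells are singletons). **Isomorphism version.**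 For an ordered partition $\vec\pi$ of $V^k$ write $[u]_{\vec\pi}=i$ if $u$ is in the $i$th cell. Put $\vec\omega_{\vec\pi}(u,w)=([\phi_1(u,w)]_{\vec\pi},\dots,[\phi_k(u,w)]_{\vec\pi})$, let $\vec\omega_{\vec\pi}(u)$ be the list of the $n$ tuples $\vec\omega_{\vec\pi}(u,w)$, $w\in V$, sorted lexicographically, and $D_{\vec\pi}(u)=([u]_{\vec\pi},\vec\omega_{\vec\pi}(u))$. For $G$: start with the ordered partition $\vec{\mathcal C}^k_G$ of $V^k$ into level sets of $u\mapsto\vec{\mathcal C}_G(u)$, ordered by a fixed lexicographic order on matrices; repeatedly replace $\vec\pi$ by the ordered partition into level sets of $D_{\vec\pi}$, ordered lexicographically by the value of $D_{\vec\pi}$, until it stabilises at $\vec\pi^*$. Likewise obtain $\vec\tau^*$ from $H$. The algorithm determines that $G$ and $H$ are not isomorphic iff it is not the case that both (a) there is a bijection $\gamma_0:V^k\to V^k$ with $\vec{\mathcal C}_G(u)=\vec{\mathcal C}_H(\gamma_0(u))$ for all $u$, and (b) there is a bijection $\gamma:V^k\to V^k$ with $D_{\vec\pi^*}(u)=D_{\vec\tau^*}(\gamma(u))$ for all $u$. *)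

theory Defs
  imports
    "HOL-Analysis.Finite_Cartesian_Product"
    "HOL-Library.Multiset"
    "HOL-Library.While_Combinator"
    "HOL-Library.List_Lexorder"
    "HOL-Library.Product_Lexorder"
    "HOL-Library.Poly_Mapping"
begin

section \<open>Real polynomials in the variables \<open>x\<^sub>i\<close>, \<open>i :: 'i\<close>\<close>

text \<open>A monomial is its finitely supported exponent function; addition and multiplication of
  polynomials are those of \<^type>\<open>poly_mapping\<close>.\<close>

type_synonym 'i polynomial = "('i \<Rightarrow>\<^sub>0 nat) \<Rightarrow>\<^sub>0 real"

definition pvar :: "'i \<Rightarrow> 'i polynomial" where
  "pvar i = Poly_Mapping.single (Poly_Mapping.single i 1) 1"

definition peval :: "('i \<Rightarrow> real) \<Rightarrow> 'i polynomial \<Rightarrow> real" where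
  "peval x p = (\<Sum>m\<in>Poly_Mapping.keys p.
     Poly_Mapping.lookup p m * (\<Prod>i\<in>Poly_Mapping.keys m. x i ^ Poly_Mapping.lookup m i))"

definition semialgebraic_set ::
    "'i polynomial set \<Rightarrow> 'i polynomial set \<Rightarrow> ('i \<Rightarrow> real) set" where
  "semialgebraic_set F G =
     {x. (\<forall>i. 0 \<le> x i \<and> x i \<le> 1) \<and> (\<forall>f\<in>F. peval x f = 0) \<and> (\<forall>g\<in>G. 0 \<le> peval x g)}"


section \<open>Sherali-Adams relaxations\<close>

text \<open>Replacing \<open>x\<^sub>i\<^sup>2\<close> by \<open>x\<^sub>i\<close> until a monomial \<open>m\<close> is square-free leaves the product of the
  \<open>x\<^sub>i\<close> with \<open>i \<in> keys m\<close>, which then becomes the new variable \<open>y (keys m)\<close>.\<close>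

definition linearise :: "('i set \<Rightarrow> real) \<Rightarrow> 'i polynomial \<Rightarrow> real" where
  "linearise y p = (\<Sum>m\<in>Poly_Mapping.keys p.
     Poly_Mapping.lookup p m * (if m = 0 then 1 else y (Poly_Mapping.keys m)))"

text \<open>Points \<open>y\<close> are indexed by all sets of variables. The coordinates that occur in no
  constraint (\<open>y {}\<close> among them) are unrestricted and do not affect the projection below.
  The constraints are used for \<open>k \<ge> 1\<close> only.\<close>

definition sherali_adams_lift ::
    "nat \<Rightarrow> 'i::finite polynomial set \<Rightarrow> 'i polynomial set \<Rightarrow> ('i set \<Rightarrow> real) set" where
  "sherali_adams_lift k F G =
     {y. (\<forall>f\<in>F. \<forall>I. card I \<le> k - 1 \<longrightarrow>
            linearise y ((\<Prod>i\<in>I. pvar i) * f) = 0) \<and>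
         (\<forall>g\<in>G. \<forall>J. \<forall>I\<subseteq>J. card J \<le> k - 1 \<longrightarrow>
            0 \<le> linearise y ((\<Prod>i\<in>I. pvar i) * (\<Prod>i\<in>J - I. 1 - pvar i) * g)) \<and>
         (\<forall>J. \<forall>I\<subseteq>J. card J \<le> k \<longrightarrow>
            0 \<le> linearise y ((\<Prod>i\<in>I. pvar i) * (\<Prod>i\<in>J - I. 1 - pvar i)))}"

definition sherali_adams ::
    "nat \<Rightarrow> 'i::finite polynomial set \<Rightarrow> 'i polynomial set \<Rightarrow> ('i \<Rightarrow> real) set" where
  "sherali_adams k F G = {x. \<exists>y\<in>sherali_adams_lift k F G. \<forall>i. x i = y {i}}"


section \<open>The graph isomorphism system\<close>

text \<open>A graph on the vertex set \<open>UNIV :: 'n set\<close> is given by its set of edges \<open>{u, v}\<close>.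
  For a simple graph \<open>{u, u}\<close> is never an edge.\<close>

definition simple_graph :: "'n set set \<Rightarrow> bool" where
  "simple_graph E \<longleftrightarrow> (\<forall>e\<in>E. card e = 2)"

definition iso_set :: "'n::finite set set \<Rightarrow> 'n set set \<Rightarrow> (real^'n^'n) set" where
  "iso_set E\<^sub>G E\<^sub>H =
     {X. (\<forall>u v. 0 \<le> X $ u $ v \<and> X $ u $ v \<le> 1) \<and>
         (\<forall>u. (\<Sum>v\<in>UNIV. X $ u $ v) = 1) \<and> (\<forall>v. (\<Sum>u\<in>UNIV. X $ u $ v) = 1) \<and>
         (\<forall>u\<^sub>1 u\<^sub>2 v\<^sub>1 v\<^sub>2. {u\<^sub>1, u\<^sub>2} \<in> E\<^sub>G \<and> {v\<^sub>1, v\<^sub>2} \<notin> E\<^sub>H \<longrightarrow> X $ u\<^sub>1 $ v\<^sub>1 * X $ u\<^sub>2 $ v\<^sub>2 = 0) \<and>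
         (\<forall>u\<^sub>1 u\<^sub>2 v\<^sub>1 v\<^sub>2. {u\<^sub>1, u\<^sub>2} \<notin> E\<^sub>G \<and> {v\<^sub>1, v\<^sub>2} \<in> E\<^sub>H \<longrightarrow> X $ u\<^sub>1 $ v\<^sub>1 * X $ u\<^sub>2 $ v\<^sub>2 = 0)}"

text \<open>The variable \<open>(u, v)\<close> stands for the matrix entry \<open>X $ u $ v\<close>.\<close>

definition iso_equations ::
    "'n::finite set set \<Rightarrow> 'n set set \<Rightarrow> ('n \<times> 'n) polynomial set" where
  "iso_equations E\<^sub>G E\<^sub>H =
     {(\<Sum>v\<in>UNIV. pvar (u, v)) - 1 | u. True} \<union>
     {(\<Sum>u\<in>UNIV. pvar (u, v)) - 1 | v. True} \<union>
     {pvar (u\<^sub>1, v\<^sub>1) * pvar (u\<^sub>2, v\<^sub>2) | u\<^sub>1 u\<^sub>2 v\<^sub>1 v\<^sub>2. {u\<^sub>1, u\<^sub>2} \<in> E\<^sub>G \<and> {v\<^sub>1, v\<^sub>2} \<notin> E\<^sub>H} \<union>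
     {pvar (u\<^sub>1, v\<^sub>1) * pvar (u\<^sub>2, v\<^sub>2) | u\<^sub>1 u\<^sub>2 v\<^sub>1 v\<^sub>2. {u\<^sub>1, u\<^sub>2} \<notin> E\<^sub>G \<and> {v\<^sub>1, v\<^sub>2} \<in> E\<^sub>H}"

definition iso_relaxation ::
    "nat \<Rightarrow> 'n::finite set set \<Rightarrow> 'n set set \<Rightarrow> (real^'n^'n) set" where
  "iso_relaxation k E\<^sub>G E\<^sub>H = {X. (\<lambda>(u, v). X $ u $ v) \<in> sherali_adams k (iso_equations E\<^sub>G E\<^sub>H) {}}"

abbreviation aut_relaxation :: "nat \<Rightarrow> 'n::finite set set \<Rightarrow> (real^'n^'n) set" where
  "aut_relaxation k E\<^sub>G \<equiv> iso_relaxation k E\<^sub>G E\<^sub>G"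

lemma peval_eq_sum:
  assumes "finite S" "Poly_Mapping.keys p \<subseteq> S"
  shows "peval x p = (\<Sum>m\<in>S.
    Poly_Mapping.lookup p m * (\<Prod>i\<in>Poly_Mapping.keys m. x i ^ Poly_Mapping.lookup m i))"
  unfolding peval_def using assms
  by (intro sum.mono_neutral_left) (auto simp: in_keys_iff)

lemma peval_add: "peval x (p + q) = peval x p + peval x q"
proof -
  let ?S = "Poly_Mapping.keys p \<union> Poly_Mapping.keys q"
  have "Poly_Mapping.keys (p + q) \<subseteq> ?S" by (rule Poly_Mapping.keys_add)
  then show ?thesis
    using peval_eq_sum[of ?S "p + q" x] peval_eq_sum[of ?S p x] peval_eq_sum[of ?S q x]
    by (simp add: lookup_add algebra_simps sum.distrib)
qed

lemma peval_diff: "peval x (p - q) = peval x p - peval x q"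
  using peval_add[of x "p - q" q] by simp

lemma peval_sum: "peval x (\<Sum>a\<in>A. f a) = (\<Sum>a\<in>A. peval x (f a))"
  by (induction A rule: infinite_finite_induct) (simp_all add: peval_add, simp_all add: peval_def)

lemma peval_one: "peval x 1 = 1"
  by (simp add: peval_def)

lemma peval_pvar: "peval x (pvar i) = x i"
  by (simp add: peval_def pvar_def)

lemma peval_pvar_mult: "peval x (pvar i * pvar j) = x i * x j"
proof (cases "i = j")
  case True
  have "Poly_Mapping.single j (Suc 0) + Poly_Mapping.single j (Suc 0) = Poly_Mapping.single j 2"
    by (simp add: numeral_2_eq_2 flip: single_add)
  with True show ?thesis
    by (simp add: peval_def pvar_def mult_single power2_eq_square)
next
  case False
  let ?m = "Poly_Mapping.single i (Suc 0) + Poly_Mapping.single j (Suc 0)"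
  have "Poly_Mapping.keys ?m = {i, j}"
    using False by (auto simp: in_keys_iff lookup_add lookup_single when_def split: if_splits)
  with False show ?thesis
    by (simp add: peval_def pvar_def mult_single lookup_add lookup_single)
qed

lemma iso_set_eq_semialgebraic_set:
  "iso_set E\<^sub>G E\<^sub>H = {X. (\<lambda>(u, v). X $ u $ v) \<in> semialgebraic_set (iso_equations E\<^sub>G E\<^sub>H) {}}"
proof -
  have "(\<forall>f\<in>iso_equations E\<^sub>G E\<^sub>H. peval x f = 0) \<longleftrightarrow>
      (\<forall>u. (\<Sum>v\<in>UNIV. x (u, v)) = 1) \<and> (\<forall>v. (\<Sum>u\<in>UNIV. x (u, v)) = 1) \<and>
      (\<forall>u\<^sub>1 u\<^sub>2 v\<^sub>1 v\<^sub>2. {u\<^sub>1, u\<^sub>2} \<in> E\<^sub>G \<and> {v\<^sub>1, v\<^sub>2} \<notin> E\<^sub>H \<longrightarrow> x (u\<^sub>1, v\<^sub>1) * x (u\<^sub>2, v\<^sub>2) = 0) \<and>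
      (\<forall>u\<^sub>1 u\<^sub>2 v\<^sub>1 v\<^sub>2. {u\<^sub>1, u\<^sub>2} \<notin> E\<^sub>G \<and> {v\<^sub>1, v\<^sub>2} \<in> E\<^sub>H \<longrightarrow> x (u\<^sub>1, v\<^sub>1) * x (u\<^sub>2, v\<^sub>2) = 0)"
    for x :: "'a \<times> 'a \<Rightarrow> real"
    unfolding iso_equations_def ball_Un conj_assoc
    by (intro conj_cong)
      (auto simp: peval_diff peval_sum peval_one peval_pvar peval_pvar_mult
            simp del: mult_eq_0_iff, (metis peval_pvar_mult)+)
  then show ?thesis
    by (simp add: iso_set_def semialgebraic_set_def)
qed


section \<open>The \<open>k\<close>-dimensional Weisfeiler-Lehman algorithm\<close>

text \<open>Tuples in \<open>V\<^sup>k\<close> are lists of length \<open>k\<close> with positions \<open>0, \<dots>, k - 1\<close>, so replacing the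
  entry at position \<open>i\<close> of \<open>u\<close> by \<open>w\<close> is the list update \<open>u[i := w]\<close>.\<close>

definition tuples :: "nat \<Rightarrow> 'n list set" where
  "tuples k = {u. length u = k}"

text \<open>The matrix is the list of its rows.\<close>

definition adj_matrix :: "'n set set \<Rightarrow> 'n list \<Rightarrow> int list list" where
  "adj_matrix E u =
     map (\<lambda>a. map (\<lambda>b. if a = b then 0 else if {a, b} \<in> E then 1 else - 1) u) u"

definition iterate_until_stable :: "('a \<Rightarrow> 'a) \<Rightarrow> 'a \<Rightarrow> 'a" where
  "iterate_until_stable f = while (\<lambda>x. f x \<noteq> x) f"

subsection \<open>Automorphism version\<close>

text \<open>Partitions of \<open>V\<^sup>k\<close> are represented by the equivalence relations on \<open>V\<^sup>k\<close>.\<close>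

definition wl_aut_init :: "nat \<Rightarrow> 'n set set \<Rightarrow> ('n list \<times> 'n list) set" where
  "wl_aut_init k E = {(u, v). u \<in> tuples k \<and> v \<in> tuples k \<and> adj_matrix E u = adj_matrix E v}"

definition wl_aut_refine ::
    "nat \<Rightarrow> ('n list \<times> 'n list) set \<Rightarrow> ('n list \<times> 'n list) set" where
  "wl_aut_refine k \<pi> =
     {(u, v) \<in> \<pi>. \<exists>\<psi>. bij \<psi> \<and> (\<forall>i<k. \<forall>w. (u[i := w], v[i := \<psi> w]) \<in> \<pi>)}"

definition wl_aut :: "nat \<Rightarrow> 'n set set \<Rightarrow> ('n list \<times> 'n list) set" where
  "wl_aut k E = iterate_until_stable (wl_aut_refine k) (wl_aut_init k E)"

definition wl_determines_asymmetric :: "nat \<Rightarrow> 'n::finite set set \<Rightarrow> bool" where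
  "wl_determines_asymmetric k E \<longleftrightarrow> (\<forall>c \<in> tuples k // wl_aut k E. is_singleton c)"

subsection \<open>Isomorphism version\<close>

text \<open>Ordered partitions are lists of cells. The lexicographic orders on lists and pairs are the
  library instances of \<^class>\<open>linorder\<close>; matrices are thus compared row by row.\<close>

definition ordered_level_sets :: "'a set \<Rightarrow> ('a \<Rightarrow> 'b::linorder) \<Rightarrow> 'a set list" where
  "ordered_level_sets A f = map (\<lambda>c. {a \<in> A. f a = c}) (sorted_list_of_set (f ` A))"

text \<open>Cells are numbered from \<open>0\<close>, which shifts all indices uniformly.\<close>

definition cell_index :: "'a set list \<Rightarrow> 'a \<Rightarrow> nat" where
  "cell_index \<pi> u = (THE i. i < length \<pi> \<and> u \<in> \<pi> ! i)"

definition wl_omega :: "'n list set list \<Rightarrow> 'n list \<Rightarrow> 'n \<Rightarrow> nat list" where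
  "wl_omega \<pi> u w = map (\<lambda>i. cell_index \<pi> (u[i := w])) [0..<length u]"

definition wl_omegas :: "'n::finite list set list \<Rightarrow> 'n list \<Rightarrow> nat list list" where
  "wl_omegas \<pi> u = sorted_list_of_multiset (image_mset (wl_omega \<pi> u) (mset_set UNIV))"

definition wl_D :: "'n::finite list set list \<Rightarrow> 'n list \<Rightarrow> nat \<times> nat list list" where
  "wl_D \<pi> u = (cell_index \<pi> u, wl_omegas \<pi> u)"

definition wl_iso_init :: "nat \<Rightarrow> 'n set set \<Rightarrow> 'n list set list" where
  "wl_iso_init k E = ordered_level_sets (tuples k) (adj_matrix E)"

definition wl_iso_refine :: "nat \<Rightarrow> 'n::finite list set list \<Rightarrow> 'n list set list" where
  "wl_iso_refine k \<pi> = ordered_level_sets (tuples k) (wl_D \<pi>)"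

definition wl_iso :: "nat \<Rightarrow> 'n::finite set set \<Rightarrow> 'n list set list" where
  "wl_iso k E = iterate_until_stable (wl_iso_refine k) (wl_iso_init k E)"

definition wl_determines_nonisomorphic ::
    "nat \<Rightarrow> 'n::finite set set \<Rightarrow> 'n set set \<Rightarrow> bool" where
  "wl_determines_nonisomorphic k E\<^sub>G E\<^sub>H \<longleftrightarrow>
     \<not> ((\<exists>\<gamma>\<^sub>0. bij_betw \<gamma>\<^sub>0 (tuples k) (tuples k) \<and>
               (\<forall>u\<in>tuples k. adj_matrix E\<^sub>G u = adj_matrix E\<^sub>H (\<gamma>\<^sub>0 u))) \<and>
        (\<exists>\<gamma>. bij_betw \<gamma> (tuples k) (tuples k) \<and>
              (\<forall>u\<in>tuples k. wl_D (wl_iso k E\<^sub>G) u = wl_D (wl_iso k E\<^sub>H) (\<gamma> u))))"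

end

theory Submission
  imports Defs "HOL-Combinatorics.Permutations"
begin

text \<open>A point of the relaxation is a nonnegative function \<open>z\<close> on sets of at most \<open>k + 1\<close> pairs with
  \<open>\<Sum>\<^sub>v z (I \<union> {(u, v)}) = z I = \<Sum>\<^sub>u z (I \<union> {(u, v)})\<close> for \<open>card I \<le> k\<close>, vanishing on sets that violate
  adjacency. If \<open>z\<close> is positive on the set of pairs of two \<open>k\<close>-tuples, then \<open>z (I \<union> {(a, b)}) / z I\<close>
  is a doubly stochastic matrix that is supported on pairs of equally coloured extensions, so
  by induction the Weisfeiler-Lehman refinement never separates such tuples.

  Conversely, the stable colouring is a bisimulation. In the coarsest bisimulation,
  call a set of pairs good if all its \<open>k\<close>-tuples are bisimilar. A good set of at most \<open>k\<close>
  pairs extends along a bijection of the vertices, and by difunctionality the number of good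
  extensions depends on its domain only. The indicator of the good sets, divided
  by the number of good sets with the same domain, is then the desired point of the relaxation.\<close>


section \<open>Linearisation\<close>

text \<open>Two mismatches shape the proof. First, the variables of the relaxation are sets of up to
  k + 1 pairs, while colours sit on k-tuples. Bisimilarity of two tuples must therefore depend on
  their set of pairs only, not on the order or repetition of entries. This is why the coarsest
  bisimulation replaces the stable colouring: by maximality it absorbs reorderings and compositions,
  and it serves both versions of the algorithm. Second, between two different graphs good sets
  cannot be composed pairwise; only zigzags of p, the converse of q, and r make sense, and they
  suffice to compare numbers of extensions. The isomorphism version has an obstacle of its own: the
  bijections (a) and (b) are unrelated, and cell numbers of two graphs are comparable only if the
  same colours occur in both. So agreement of colours is propagated together with agreement of the
  sets of colours on all of V^k, and adjacency along the bijection (b) is recovered from the order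
  of the cells.\<close>

definition sqfree_value :: "('i set \<Rightarrow> real) \<Rightarrow> 'i set \<Rightarrow> real" where
  "sqfree_value y I = (if I = {} then 1 else y I)"

lemma linearise_eq_sum:
  assumes "finite S" "Poly_Mapping.keys p \<subseteq> S"
  shows "linearise y p = (\<Sum>m\<in>S. Poly_Mapping.lookup p m * sqfree_value y (Poly_Mapping.keys m))"
proof -
  have "linearise y p =
      (\<Sum>m\<in>Poly_Mapping.keys p. Poly_Mapping.lookup p m * sqfree_value y (Poly_Mapping.keys m))"
    unfolding linearise_def sqfree_value_def by (intro sum.cong) auto
  also have "\<dots> = (\<Sum>m\<in>S. Poly_Mapping.lookup p m * sqfree_value y (Poly_Mapping.keys m))"
    using assms by (intro sum.mono_neutral_left) (auto simp: in_keys_iff)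
  finally show ?thesis .
qed

lemma linearise_add: "linearise y (p + q) = linearise y p + linearise y q"
proof -
  let ?S = "Poly_Mapping.keys p \<union> Poly_Mapping.keys q"
  have "Poly_Mapping.keys (p + q) \<subseteq> ?S" by (rule Poly_Mapping.keys_add)
  then show ?thesis
    using linearise_eq_sum[of ?S "p + q" y] linearise_eq_sum[of ?S p y] linearise_eq_sum[of ?S q y]
    by (simp add: lookup_add algebra_simps sum.distrib)
qed

lemma linearise_diff: "linearise y (p - q) = linearise y p - linearise y q"
  using linearise_add[of y "p - q" q] by simp

lemma linearise_sum: "linearise y (\<Sum>a\<in>A. f a) = (\<Sum>a\<in>A. linearise y (f a))"
  by (induction A rule: infinite_finite_induct)
    (simp_all add: linearise_add, simp_all add: linearise_def)

abbreviation monomial :: "('i \<Rightarrow>\<^sub>0 nat) \<Rightarrow> 'i polynomial" where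
  "monomial m \<equiv> Poly_Mapping.single m 1"

lemma linearise_monomial: "linearise y (monomial m) = sqfree_value y (Poly_Mapping.keys m)"
  by (subst linearise_eq_sum[of "{m}"]) auto

lemma monomial_mult_pvar: "monomial m * pvar i = monomial (m + Poly_Mapping.single i 1)"
  by (simp add: pvar_def mult_single)

lemma keys_add_nat:
  "Poly_Mapping.keys (m + n) = Poly_Mapping.keys m \<union> Poly_Mapping.keys (n :: 'i \<Rightarrow>\<^sub>0 nat)"
  by (auto simp: in_keys_iff lookup_add)

lemma keys_mult_pvar:
  "Poly_Mapping.keys (m + Poly_Mapping.single i (1::nat)) = insert i (Poly_Mapping.keys m)"
  by (auto simp: keys_add_nat)

lemma prod_pvar:
  assumes "finite I"
  obtains m where "(\<Prod>i\<in>I. pvar i) = monomial m" "Poly_Mapping.keys m = I"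
proof -
  from assms have "\<exists>m. (\<Prod>i\<in>I. pvar i) = monomial m \<and> Poly_Mapping.keys m = I"
  proof (induction I rule: finite_induct)
    case empty
    show ?case by (rule exI[of _ 0]) simp
  next
    case (insert i I)
    then obtain m where m: "(\<Prod>i\<in>I. pvar i) = monomial m" "Poly_Mapping.keys m = I" by blast
    with insert show ?case
      by (intro exI[of _ "m + Poly_Mapping.single i 1"])
        (simp only: prod.insert mult.commute[of "pvar i"] monomial_mult_pvar keys_mult_pvar simp_thms)
  qed
  then show thesis using that by blast
qed


section \<open>The relaxation as a linear system on sets of pairs\<close>

text \<open>The constraints of level k + 1, so multipliers I have at most k elements. The factors 1
  - x_i are absent: \<open>literal_value_nonneg\<close> recovers them from nonnegativity and the row
  equations. The equivalence in the last clause merges the two families of quadratic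
  equations.\<close>

definition feasible ::
    "nat \<Rightarrow> 'n::finite set set \<Rightarrow> 'n set set \<Rightarrow> (('n \<times> 'n) set \<Rightarrow> real) \<Rightarrow> bool" where
  "feasible k E F z \<longleftrightarrow> z {} = 1 \<and> (\<forall>I. card I \<le> Suc k \<longrightarrow> 0 \<le> z I) \<and>
     (\<forall>I u. card I \<le> k \<longrightarrow> (\<Sum>v\<in>UNIV. z (insert (u, v) I)) = z I) \<and>
     (\<forall>I v. card I \<le> k \<longrightarrow> (\<Sum>u\<in>UNIV. z (insert (u, v) I)) = z I) \<and>
     (\<forall>I a b c d. card I \<le> k \<and> ({a, b} \<in> E \<longleftrightarrow> {c, d} \<notin> F) \<longrightarrow>
        z (insert (a, c) (insert (b, d) I)) = 0)"

lemma feasibleD: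
  assumes "feasible k E F z"
  shows "z {} = 1"
    and "card I \<le> Suc k \<Longrightarrow> 0 \<le> z I"
    and "card I \<le> k \<Longrightarrow> (\<Sum>v\<in>UNIV. z (insert (u, v) I)) = z I"
    and "card I \<le> k \<Longrightarrow> (\<Sum>u\<in>UNIV. z (insert (u, v) I)) = z I"
    and "card I \<le> k \<Longrightarrow> ({a, b} \<in> E \<longleftrightarrow> {c, d} \<notin> F) \<Longrightarrow> z (insert (a, c) (insert (b, d) I)) = 0"
  using assms unfolding feasible_def by blast+

lemma linearise_monomial_row:
  "linearise y (monomial m * ((\<Sum>v\<in>A. pvar (g v)) - 1)) =
     (\<Sum>v\<in>A. sqfree_value y (insert (g v) (Poly_Mapping.keys m))) - sqfree_value y (Poly_Mapping.keys m)"
  by (simp add: right_diff_distrib sum_distrib_left linearise_diff linearise_sum linearise_monomial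
      monomial_mult_pvar keys_mult_pvar[simplified])

lemma linearise_monomial_pair:
  "linearise y (monomial m * (pvar a * pvar b)) = sqfree_value y (insert a (insert b (Poly_Mapping.keys m)))"
  by (simp add: mult.assoc[symmetric] linearise_monomial monomial_mult_pvar keys_mult_pvar[simplified] insert_commute)

text \<open>Reading y as a distribution on sets of pairs, this is the weight of the sets that
  contain \<open>keys m\<close> and avoid K. A monomial m stands in place of a set because
  multiplying by a variable of \<open>keys m\<close> produces a square, which linearisation
  ignores.\<close>

definition literal_value :: "('i set \<Rightarrow> real) \<Rightarrow> ('i \<Rightarrow>\<^sub>0 nat) \<Rightarrow> 'i set \<Rightarrow> real" where
  "literal_value y m K = linearise y (monomial m * (\<Prod>i\<in>K. 1 - pvar i))"

lemma literal_value_insert: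
  assumes "finite K" "i \<notin> K"
  shows "literal_value y m (insert i K) =
    literal_value y m K - literal_value y (m + Poly_Mapping.single i 1) K"
proof -
  have "monomial m * (\<Prod>i\<in>insert i K. 1 - pvar i) =
      monomial m * (\<Prod>i\<in>K. 1 - pvar i) - monomial m * pvar i * (\<Prod>i\<in>K. 1 - pvar i)"
    using assms by (simp add: algebra_simps)
  then show ?thesis
    by (simp add: literal_value_def linearise_diff monomial_mult_pvar)
qed

text \<open>Expanding the product over K leaves monomials with at most k variables, and to each of
  them the row equation applies.\<close>

lemma literal_value_row:
  fixes z :: "('n::finite \<times> 'n) set \<Rightarrow> real"
  assumes "feasible k E F (sqfree_value z)" "finite K" "card (Poly_Mapping.keys m) + card K \<le> k"
  shows "literal_value z m K = (\<Sum>v\<in>UNIV. literal_value z (m + Poly_Mapping.single (u, v) 1) K)"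
  using assms(2,3)
proof (induction K arbitrary: m rule: finite_induct)
  case empty
  then show ?case
    using feasibleD(3)[OF assms(1), of "Poly_Mapping.keys m" u]
    by (simp add: literal_value_def linearise_monomial keys_mult_pvar[simplified])
next
  case (insert i K)
  let ?m = "m + Poly_Mapping.single i 1"
  have "card (Poly_Mapping.keys ?m) \<le> Suc (card (Poly_Mapping.keys m))"
    by (simp add: keys_mult_pvar[simplified] card_insert_le_m1 card_insert_if)
  then have le: "card (Poly_Mapping.keys ?m) + card K \<le> k" "card (Poly_Mapping.keys m) + card K \<le> k"
    using insert.prems insert.hyps by simp_all
  have "literal_value z m (insert i K) =
      (\<Sum>v\<in>UNIV. literal_value z (m + Poly_Mapping.single (u, v) 1) K) -
      (\<Sum>v\<in>UNIV. literal_value z (?m + Poly_Mapping.single (u, v) 1) K)"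
    unfolding literal_value_insert[OF insert.hyps]
    by (simp only: insert.IH[OF le(1)] insert.IH[OF le(2)])
  also have "\<dots> = (\<Sum>v\<in>UNIV. literal_value z (m + Poly_Mapping.single (u, v) 1) (insert i K))"
    using insert.hyps by (simp add: literal_value_insert sum_subtractf add.assoc add.commute[of "Poly_Mapping.single i _"])
  finally show ?case .
qed

text \<open>By the row equation, \<open>1 - x\<^sub>u\<^sub>v\<close> is the sum of the other entries of row \<open>u\<close>, so a factor
  \<open>1 - x\<^sub>i\<close> can be traded for a sum of variables without raising the degree.\<close>

lemma literal_value_nonneg:
  fixes z :: "('n::finite \<times> 'n) set \<Rightarrow> real"
  assumes "feasible k E F (sqfree_value z)" "finite K" "card (Poly_Mapping.keys m) + card K \<le> Suc k"
  shows "0 \<le> literal_value z m K"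
  using assms(2,3)
proof (induction K arbitrary: m rule: finite_induct)
  case empty
  then show ?case
    using feasibleD(2)[OF assms(1), of "Poly_Mapping.keys m"]
    by (simp add: literal_value_def linearise_monomial)
next
  case (insert i K)
  obtain u v where i: "i = (u, v)" by (cases i)
  let ?L = "\<lambda>b. literal_value z (m + Poly_Mapping.single (u, b) 1) K"
  have nonneg: "0 \<le> ?L b" for b
  proof (rule insert.IH)
    have "card (Poly_Mapping.keys (m + Poly_Mapping.single (u, b) (1::nat))) \<le> Suc (card (Poly_Mapping.keys m))"
      by (simp add: keys_mult_pvar[simplified] card_insert_if)
    then show "card (Poly_Mapping.keys (m + Poly_Mapping.single (u, b) 1)) + card K \<le> Suc k"
      using insert.prems insert.hyps by simp
  qed
  \<comment> \<open>Without i the total size is at most k, as \<open>literal_value_row\<close>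
    requires.\<close>
  have "literal_value z m (insert i K) = (\<Sum>b\<in>UNIV. ?L b) - ?L v"
    using literal_value_row[OF assms(1) insert.hyps(1), of m u] insert.prems insert.hyps i
    by (simp add: literal_value_insert)
  also have "\<dots> = (\<Sum>b\<in>UNIV - {v}. ?L b)" by (simp add: sum_diff1)
  also have "0 \<le> \<dots>" by (intro sum_nonneg nonneg)
  finally show ?case .
qed

text \<open>The lift leaves \<open>y {}\<close> free, while the empty monomial counts as 1;
  \<open>sqfree_value\<close> resets that coordinate, so that \<open>feasible\<close> may demand the
  value 1 there.\<close>

lemma sherali_adams_lift_iff_feasible:
  fixes y :: "('n::finite \<times> 'n) set \<Rightarrow> real"
  shows "y \<in> sherali_adams_lift (Suc k) (iso_equations E F) {} \<longleftrightarrow> feasible k E F (sqfree_value y)"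
    (is "?L \<longleftrightarrow> ?R")
proof
  assume L: ?L
  have eq: "linearise y ((\<Prod>i\<in>I. pvar i) * f) = 0" if "f \<in> iso_equations E F" "card I \<le> k" for f I
    using L that by (simp add: sherali_adams_lift_def)
  show ?R unfolding feasible_def
  proof (intro conjI allI impI)
    show "sqfree_value y {} = 1" by (simp add: sqfree_value_def)
  next
    fix I :: "('n \<times> 'n) set" assume "card I \<le> Suc k"
    \<comment> \<open>The case J = I has no factor 1 - x_i and is plain nonnegativity of
      \<open>sqfree_value y I\<close>.\<close>
    then have "0 \<le> linearise y ((\<Prod>i\<in>I. pvar i) * (\<Prod>i\<in>I - I. 1 - pvar i))"
      using L by (simp add: sherali_adams_lift_def del: Diff_cancel)
    moreover obtain m where "(\<Prod>i\<in>I. pvar i) = monomial m" "Poly_Mapping.keys m = I"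
      using prod_pvar[of I] by auto
    ultimately show "0 \<le> sqfree_value y I" by (simp add: linearise_monomial)
  next
    fix I :: "('n \<times> 'n) set" and u assume I: "card I \<le> k"
    obtain m where m: "(\<Prod>i\<in>I. pvar i) = monomial m" "Poly_Mapping.keys m = I"
      using prod_pvar[of I] by auto
    have "(\<Sum>v\<in>UNIV. pvar (u, v)) - 1 \<in> iso_equations E F" 
      by (auto simp: iso_equations_def)
    from eq[OF this I] show "(\<Sum>v\<in>UNIV. sqfree_value y (insert (u, v) I)) = sqfree_value y I"
      by (simp add: m linearise_monomial_row)
  next
    fix I :: "('n \<times> 'n) set" and v assume I: "card I \<le> k"
    obtain m where m: "(\<Prod>i\<in>I. pvar i) = monomial m" "Poly_Mapping.keys m = I"
      using prod_pvar[of I] by auto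
    have "(\<Sum>u\<in>UNIV. pvar (u, v)) - 1 \<in> iso_equations E F" 
      by (auto simp: iso_equations_def)
    from eq[OF this I] show "(\<Sum>u\<in>UNIV. sqfree_value y (insert (u, v) I)) = sqfree_value y I"
      by (simp add: m linearise_monomial_row)
  next
    fix I :: "('n \<times> 'n) set" and a b c d 
    assume *: "card I \<le> k \<and> ({a, b} \<in> E) = ({c, d} \<notin> F)"
    obtain m where m: "(\<Prod>i\<in>I. pvar i) = monomial m" "Poly_Mapping.keys m = I"
      using prod_pvar[of I] by auto
    have "pvar (a, c) * pvar (b, d) \<in> iso_equations E F"
      using * unfolding iso_equations_def by blast
    from eq[OF this, of I] * show "sqfree_value y (insert (a, c) (insert (b, d) I)) = 0"
      by (simp add: m linearise_monomial_pair)
  qed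
next
  assume R: ?R
  have "linearise y ((\<Prod>i\<in>I. pvar i) * f) = 0" if f: "f \<in> iso_equations E F" and I: "card I \<le> k" for f I
  proof -
    obtain m where m: "(\<Prod>i\<in>I. pvar i) = monomial m" "Poly_Mapping.keys m = I"
      using prod_pvar[of I] by auto
    from f consider u where "f = (\<Sum>v\<in>UNIV. pvar (u, v)) - 1"
      | v where "f = (\<Sum>u\<in>UNIV. pvar (u, v)) - 1"
      | a b c d where "f = pvar (a, c) * pvar (b, d)" "{a, b} \<in> E \<longleftrightarrow> {c, d} \<notin> F"
      unfolding iso_equations_def by blast
    then show ?thesis
    proof cases
      case 1
      then show ?thesis using feasibleD(3)[OF R I] by (simp add: m linearise_monomial_row)
    next
      case 2
      then show ?thesis using feasibleD(4)[OF R I] by (simp add: m linearise_monomial_row)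
    next
      case 3
      then show ?thesis using feasibleD(5)[OF R I] by (simp add: m linearise_monomial_pair)
    qed
  qed
  moreover have "0 \<le> linearise y ((\<Prod>i\<in>I. pvar i) * (\<Prod>i\<in>J - I. 1 - pvar i))"
    if "I \<subseteq> J" "card J \<le> Suc k" for I J
  proof -
    obtain m where m: "(\<Prod>i\<in>I. pvar i) = monomial m" "Poly_Mapping.keys m = I"
      using prod_pvar[of I] by auto
    have "card I + card (J - I) = card J"
      using that by (simp add: card_Diff_subset card_mono)
    then have "0 \<le> literal_value y m (J - I)"
      using that m by (intro literal_value_nonneg[OF R]) auto
    then show ?thesis by (simp add: literal_value_def m)
  qed
  ultimately show ?L by (auto simp: sherali_adams_lift_def)
qed

lemma iso_relaxation_iff_feasible:
  fixes X :: "real^'n::finite^'n"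
  shows "X \<in> iso_relaxation (Suc k) E F \<longleftrightarrow>
    (\<exists>z. feasible k E F z \<and> (\<forall>u v. X $ u $ v = z {(u, v)}))"
proof
  assume "X \<in> iso_relaxation (Suc k) E F"
  then obtain y where y: "y \<in> sherali_adams_lift (Suc k) (iso_equations E F) {}"
    and X: "\<And>u v. X $ u $ v = y {(u, v)}"
    unfolding iso_relaxation_def sherali_adams_def by auto
  from y X show "\<exists>z. feasible k E F z \<and> (\<forall>u v. X $ u $ v = z {(u, v)})"
    by (intro exI[of _ "sqfree_value y"]) (simp add: sherali_adams_lift_iff_feasible sqfree_value_def)
next
  assume "\<exists>z. feasible k E F z \<and> (\<forall>u v. X $ u $ v = z {(u, v)})"
  then obtain z where z: "feasible k E F z" and X: "\<And>u v. X $ u $ v = z {(u, v)}" by blast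
  have "sqfree_value z = z"
    using feasibleD(1)[OF z] by (auto simp: sqfree_value_def)
  with z have "z \<in> sherali_adams_lift (Suc k) (iso_equations E F) {}"
    by (simp add: sherali_adams_lift_iff_feasible)
  with X show "X \<in> iso_relaxation (Suc k) E F"
    unfolding iso_relaxation_def sherali_adams_def by auto
qed

section \<open>Positive sets of pairs are partial isomorphisms\<close>

lemma feasible_antimono:
  assumes "feasible k E F z" "card I \<le> Suc k" "J \<subseteq> I"
  shows "z I \<le> z J"
proof -
  \<comment> \<open>\<open>z (insert x I)\<close> is one of the nonnegative summands in a row
    equation with total \<open>z I\<close>.\<close>
  have step: "z (insert x I) \<le> z I" if "card I \<le> k" for x I
  proof -
    obtain u v where x: "x = (u, v)" by (cases x)
    have "z (insert (u, v) I) \<le> (\<Sum>v\<in>UNIV. z (insert (u, v) I))"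
      using that by (intro member_le_sum feasibleD(2)[OF assms(1)]) (auto simp: card_insert_if)
    then show ?thesis using feasibleD(3)[OF assms(1) that] x by simp
  qed
  have "card (J \<union> A) \<le> Suc k \<longrightarrow> z (J \<union> A) \<le> z J" if "finite A" for A
    using that
  proof (induction A rule: finite_induct)
    case (insert x A)
    show ?case
    proof (cases "x \<in> J")
      case True
      then show ?thesis using insert by (simp add: insert_absorb)
    next
      case False
      then have "card (insert x (J \<union> A)) = Suc (card (J \<union> A))"
        using insert by simp
      then show ?thesis using step[of "J \<union> A" x] insert.IH by force
    qed
  qed simp
  from this[of I] show ?thesis using assms by (simp add: Un_absorb1)
qed

lemma converse_insert: "(insert (a, b) R)\<inverse> = insert (b, a) (R\<inverse>)"
  by auto

text \<open>Exchanging the graphs exchanges rows and columns, so a fact proved from the row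
  equations yields its column version.\<close>

lemma feasible_converse:
  assumes "feasible k E F z"
  shows "feasible k F E (\<lambda>I. z (I\<inverse>))"
proof -
  show ?thesis
    unfolding feasible_def converse_insert
  proof (intro conjI allI impI)
    show "z ({}\<inverse>) = 1" using feasibleD(1)[OF assms] by simp
  qed (use feasibleD(2-)[OF assms] in \<open>simp_all add: card_inverse\<close>)
qed

text \<open>In the row equation for the set {(a, b)} and row a, the summand v = b already equals the
  right-hand side, so the other summands vanish; antimonotonicity passes this on to larger
  sets.\<close>

lemma feasible_functional:
  assumes "feasible k E F z" "1 \<le> k" "card I \<le> Suc k" "0 < z I" "(a, b) \<in> I" "(a, c) \<in> I"
  shows "b = c"
proof (rule ccontr)
  assume "b \<noteq> c"
  have "(\<Sum>v\<in>UNIV. z {(a, v), (a, b)}) = z {(a, b)}"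
    using feasibleD(3)[OF assms(1), of "{(a, b)}" a] assms(2) by simp
  then have "(\<Sum>v\<in>UNIV - {b}. z {(a, v), (a, b)}) = 0"
    by (simp add: sum_diff1)
  moreover have "0 \<le> z {(a, v), (a, b)}" for v
    using assms(2) by (intro feasibleD(2)[OF assms(1)]) (auto simp: card_insert_if)
  ultimately have "z {(a, c), (a, b)} = 0"
    using \<open>b \<noteq> c\<close> by (simp add: sum_nonneg_eq_0_iff)
  moreover have "z I \<le> z {(a, c), (a, b)}"
    using assms by (intro feasible_antimono[OF assms(1)]) auto
  ultimately show False using assms by simp
qed

lemma feasible_injective:
  assumes "feasible k E F z" "1 \<le> k" "card I \<le> Suc k" "0 < z I" "(a, c) \<in> I" "(b, c) \<in> I"
  shows "a = b"
  using feasible_functional[OF feasible_converse[OF assms(1)], of "I\<inverse>" c a b] assms(2-)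
  by simp

lemma feasible_edge:
  assumes "feasible k E F z" "1 \<le> k" "card I \<le> Suc k" "0 < z I" "(a, c) \<in> I" "(b, d) \<in> I"
  shows "{a, b} \<in> E \<longleftrightarrow> {c, d} \<in> F"
proof (rule ccontr)
  assume "\<not> ?thesis"
  then have "z {(a, c), (b, d)} = 0"
    using feasibleD(5)[OF assms(1), of "{}" a b c d] by auto
  moreover have "z I \<le> z {(a, c), (b, d)}"
    using assms by (intro feasible_antimono[OF assms(1)]) auto
  ultimately show False using assms by simp
qed

lemma adj_matrix_eq_iff:
  "adj_matrix E u = adj_matrix F v \<longleftrightarrow> length u = length v \<and>
     (\<forall>i<length u. \<forall>j<length u. (u ! i = u ! j \<longleftrightarrow> v ! i = v ! j) \<and>
        (u ! i \<noteq> u ! j \<longrightarrow> ({u ! i, u ! j} \<in> E \<longleftrightarrow> {v ! i, v ! j} \<in> F)))"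
proof -
  have "adj_matrix E u = adj_matrix F v \<longleftrightarrow> length u = length v \<and>
     (\<forall>i<length u. \<forall>j<length u. (if u ! i = u ! j then 0 else if {u ! i, u ! j} \<in> E then 1 else - 1 :: int) =
       (if v ! i = v ! j then 0 else if {v ! i, v ! j} \<in> F then 1 else - 1))"
    unfolding adj_matrix_def
    by (cases "length u = length v") (simp_all add: list_eq_iff_nth_eq split del: if_split)
  also have "\<dots> \<longleftrightarrow> length u = length v \<and>
     (\<forall>i<length u. \<forall>j<length u. (u ! i = u ! j \<longleftrightarrow> v ! i = v ! j) \<and>
        (u ! i \<noteq> u ! j \<longrightarrow> ({u ! i, u ! j} \<in> E \<longleftrightarrow> {v ! i, v ! j} \<in> F)))"
    by (intro conj_cong refl all_cong) (simp split: if_split)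
  finally show ?thesis .
qed

lemma card_set_zip_le: "length u = k \<Longrightarrow> card (set (zip u v)) \<le> k"
  by (rule order_trans[OF card_length]) simp

lemma feasible_adj_matrix:
  assumes "feasible k E F z" "1 \<le> k" "length u = k" "length v = k" "0 < z (set (zip u v))"
  shows "adj_matrix E u = adj_matrix F v"
proof -
  have c: "card (set (zip u v)) \<le> Suc k"
    using card_set_zip_le[OF assms(3), of v] by simp
  have mem: "(u ! i, v ! i) \<in> set (zip u v)" if "i < k" for i
    using that assms by (auto simp: in_set_zip)
  show ?thesis
    unfolding adj_matrix_eq_iff assms(3,4)
  proof (intro conjI refl allI impI)
    fix i j assume ij: "i < k" "j < k"
    show "u ! i = u ! j \<longleftrightarrow> v ! i = v ! j"
      using feasible_functional[OF assms(1,2) c assms(5)] feasible_injective[OF assms(1,2) c assms(5)]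
        mem[OF ij(1)] mem[OF ij(2)] by metis
    show "{u ! i, u ! j} \<in> E \<longleftrightarrow> {v ! i, v ! j} \<in> F"
      by (rule feasible_edge[OF assms(1,2) c assms(5) mem[OF ij(1)] mem[OF ij(2)]])
  qed
qed


section \<open>Systems of extendable partial isomorphisms\<close>

text \<open>The counting needs no edges, only these closure properties. Only zigzags compose between
  two graphs, hence the three factors in \<open>P_comp\<close>. Good sets of size k + 1 arise from
  \<open>P_extend\<close> but need not extend further.\<close>

locale partial_iso_system =
  fixes k :: nat and P :: "('n::finite \<times> 'n) set \<Rightarrow> bool"
  assumes P_empty: "P {}"
    and P_antimono: "\<And>p q. P p \<Longrightarrow> q \<subseteq> p \<Longrightarrow> P q"
    and P_extend: "\<And>p. P p \<Longrightarrow> card p \<le> k \<Longrightarrow> \<exists>\<psi>. bij \<psi> \<and> (\<forall>a. P (insert (a, \<psi> a) p))"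
    and P_comp: "\<And>p q r. P p \<Longrightarrow> P q \<Longrightarrow> P r \<Longrightarrow> P (p O q\<inverse> O r)"
    and P_functional: "\<And>p a b c. P p \<Longrightarrow> (a, b) \<in> p \<Longrightarrow> (a, c) \<in> p \<Longrightarrow> b = c"
    and P_injective: "\<And>p a b c. P p \<Longrightarrow> (a, c) \<in> p \<Longrightarrow> (b, c) \<in> p \<Longrightarrow> a = b"
begin

lemma partial_iso_system_converse: "partial_iso_system k (\<lambda>p. P (p\<inverse>))"
proof
  show "P ({}\<inverse>)" using P_empty by simp
  show "P (q\<inverse>)" if "P (p\<inverse>)" "q \<subseteq> p" for p q
    using P_antimono[OF that(1)] that(2) by auto
  show "\<exists>\<psi>. bij \<psi> \<and> (\<forall>a. P ((insert (a, \<psi> a) p)\<inverse>))" if p: "P (p\<inverse>)" "card p \<le> k" for p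
  proof -
    obtain \<psi> where \<psi>: "bij \<psi>" "\<And>a. P (insert (a, \<psi> a) (p\<inverse>))"
      using P_extend[OF p(1)] p(2) by auto
    have "(insert (a, inv \<psi> a) p)\<inverse> = insert (inv \<psi> a, \<psi> (inv \<psi> a)) (p\<inverse>)" for a
      using \<psi>(1) by (auto simp: bij_is_surj surj_f_inv_f)
    with \<psi> show ?thesis by (intro exI[of _ "inv \<psi>"]) (simp add: bij_imp_bij_inv)
  qed
  show "P ((p O q\<inverse> O r)\<inverse>)" if "P (p\<inverse>)" "P (q\<inverse>)" "P (r\<inverse>)" for p q r
    using P_comp[OF that(3,2,1)] by (simp add: converse_relcomp O_assoc)
  show "b = c" if "P (p\<inverse>)" "(a, b) \<in> p" "(a, c) \<in> p" for p a b c
    using P_injective[OF that(1)] that by auto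
  show "a = b" if "P (p\<inverse>)" "(a, c) \<in> p" "(b, c) \<in> p" for p a b c
    using P_functional[OF that(1)] that by auto
qed

section \<open>Counting good sets and their extensions\<close>

lemma card_Domain: "P p \<Longrightarrow> card (Domain p) = card p"
  unfolding Domain_fst
  by (rule card_image) (auto simp: inj_on_def dest: P_functional)

definition num_on :: "'n set \<Rightarrow> nat" where
  "num_on d = card {q. P q \<and> Domain q = d}"

definition num_ext :: "'n \<Rightarrow> ('n \<times> 'n) set \<Rightarrow> nat" where
  "num_ext u q = card {b. P (insert (u, b) q)}"

text \<open>The uniform distribution on the good sets with a common domain. The cut-off lets
  \<open>weight_converse\<close> hold for sets of every size, although
  \<open>num_on_converse\<close> is restricted to size \<open>Suc k\<close>.\<close>

definition weight :: "('n \<times> 'n) set \<Rightarrow> real" where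
  "weight p = (if P p \<and> card p \<le> Suc k then 1 / num_on (Domain p) else 0)"

lemma num_on_pos: "P p \<Longrightarrow> 0 < num_on (Domain p)"
  unfolding num_on_def by (subst card_gt_0_iff) auto

lemma num_ext_pos:
  assumes "P q" "card q \<le> k"
  shows "0 < num_ext u q"
  using P_extend[OF assms] unfolding num_ext_def by (subst card_gt_0_iff) auto

text \<open>Fix extensions \<psi> of q and \<psi>' of q'. An extension of q by (u, b) is carried to
  one of q' by a zigzag: from u to b, back from b to w = \<open>inv \<psi> b\<close>, and on to
  \<open>\<psi>' w\<close>. The resulting map on images of u is injective.\<close>

lemma num_ext_le:
  assumes q: "P q" "P q'" "Domain q = Domain q'" "card q \<le> k"
  shows "num_ext u q \<le> num_ext u q'"
proof -
  have "card q' \<le> k" using q card_Domain[of q] card_Domain[of q'] by simp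
  then obtain \<psi>' where \<psi>': "bij \<psi>'" "\<And>a. P (insert (a, \<psi>' a) q')"
    using P_extend[OF q(2)] by blast
  obtain \<psi> where \<psi>: "bij \<psi>" "\<And>a. P (insert (a, \<psi> a) q)"
    using P_extend[OF q(1,4)] by blast
  have "P (insert (u, \<psi>' (inv \<psi> b)) q')" if b: "P (insert (u, b) q)" for b
  proof -
    define w where "w = inv \<psi> b"
    have w: "\<psi> w = b" using \<psi>(1) by (simp add: w_def bij_is_surj surj_f_inv_f)
    have "P (insert (u, b) q O (insert (w, b) q)\<inverse> O insert (w, \<psi>' w) q')"
      using P_comp[OF b \<psi>(2)[of w] \<psi>'(2)[of w]] w by simp
    moreover have "insert (u, \<psi>' w) q' \<subseteq> insert (u, b) q O (insert (w, b) q)\<inverse> O insert (w, \<psi>' w) q'"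
    proof -
      \<comment> \<open>Equal domains: from x follow a pair of q forth and back before applying
        q'.\<close>
      have "q' \<subseteq> q O q\<inverse> O q'"
      proof clarify
        fix x y assume xy: "(x, y) \<in> q'"
        with q(3) obtain z where "(x, z) \<in> q" by blast
        with xy show "(x, y) \<in> q O q\<inverse> O q'" by blast
      qed
      also have "\<dots> \<subseteq> insert (u, b) q O (insert (w, b) q)\<inverse> O insert (w, \<psi>' w) q'"
        by (intro relcomp_mono) auto
      finally show ?thesis by blast
    qed
    ultimately show ?thesis unfolding w_def by (rule P_antimono)
  qed
  moreover have "inj (\<lambda>b. \<psi>' (inv \<psi> b))"
    using bij_is_inj[OF bij_comp[OF bij_imp_bij_inv[OF \<psi>(1)] \<psi>'(1)]] by (simp add: comp_def)
  ultimately show ?thesis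
    unfolding num_ext_def by (intro card_inj_on_le[where f = "\<lambda>b. \<psi>' (inv \<psi> b)"]) (auto intro: inj_on_subset)
qed

lemma num_ext_eq:
  assumes "P q" "P q'" "Domain q = Domain q'" "card q \<le> k"
  shows "num_ext u q = num_ext u q'"
  using num_ext_le[of q q'] num_ext_le[of q' q] assms card_Domain[of q] card_Domain[of q']
  by (simp add: le_antisym)

text \<open>A good set with the larger domain is a good set with domain \<open>Domain p\<close> plus
  an image for u; by \<open>num_ext_eq\<close> the number of possible images is the same for all of
  them.\<close>

lemma num_on_insert:
  assumes p: "P p" "card p \<le> k" "u \<notin> Domain p"
  shows "num_on (insert u (Domain p)) = num_on (Domain p) * num_ext u p"
proof -
  let ?Q = "{q. P q \<and> Domain q = Domain p}"
  let ?S = "SIGMA q:?Q. {b. P (insert (u, b) q)}"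
  have "bij_betw (\<lambda>(q, b). insert (u, b) q) ?S {q. P q \<and> Domain q = insert u (Domain p)}"
  proof (intro bij_betwI')
    fix x y assume "x \<in> ?S" "y \<in> ?S"
    then obtain q b q' b' where x: "x = (q, b)" "y = (q', b')"
      and q: "Domain q = Domain p" "Domain q' = Domain p" by auto
    have "u \<notin> Domain q" "u \<notin> Domain q'" using q p by auto
    then have *: "(u, c) \<notin> q" "(u, c) \<notin> q'" for c by auto
    then have "insert (u, b) q = insert (u, b') q' \<Longrightarrow> b = b'" by (metis insertE insertI1 prod.inject)
    then have "insert (u, b) q = insert (u, b') q' \<longleftrightarrow> q = q' \<and> b = b'"
      using insert_ident[OF *[of b]] by blast
    then show "(case x of (q, b) \<Rightarrow> insert (u, b) q) = (case y of (q, b) \<Rightarrow> insert (u, b) q) \<longleftrightarrow> x = y"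
      unfolding x by simp
  next
    fix x assume "x \<in> ?S"
    then show "(case x of (q, b) \<Rightarrow> insert (u, b) q) \<in> {q. P q \<and> Domain q = insert u (Domain p)}"
      by auto
  next
    fix r assume "r \<in> {q. P q \<and> Domain q = insert u (Domain p)}"
    then have r: "P r" "Domain r = insert u (Domain p)" by auto
    then obtain b where b: "(u, b) \<in> r" by blast
    let ?q = "{x \<in> r. fst x \<noteq> u}"
    have "insert (u, b) ?q = r" using b P_functional[OF r(1)] by auto
    moreover have "Domain ?q = Domain p"
    proof -
      have "Domain ?q = Domain r - {u}" by force
      then show ?thesis using r(2) p(3) by auto
    qed
    moreover have "P ?q" by (rule P_antimono[OF r(1)]) auto
    ultimately show "\<exists>x\<in>?S. r = (case x of (q, b) \<Rightarrow> insert (u, b) q)"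
      using r by (intro bexI[of _ "(?q, b)"]) auto
  qed
  then have "num_on (insert u (Domain p)) = card ?S"
    unfolding num_on_def by (rule bij_betw_same_card[symmetric])
  also have "\<dots> = (\<Sum>q\<in>?Q. num_ext u q)"
    unfolding num_ext_def by (subst card_SigmaI) auto
  also have "\<dots> = (\<Sum>q\<in>?Q. num_ext u p)"
  proof (intro sum.cong refl num_ext_eq)
    fix q assume "q \<in> ?Q"
    then show "P q" "P p" "Domain q = Domain p" "card q \<le> k"
      using p card_Domain[of q] card_Domain[of p] by auto
  qed
  finally show ?thesis by (simp add: num_on_def)
qed

text \<open>If u is new, the \<open>num_ext u p\<close> good extensions share the weight of p
  equally; if p already maps u, functionality leaves a single nonzero term.\<close>

lemma weight_row:
  assumes "card p \<le> k"
  shows "(\<Sum>v\<in>UNIV. weight (insert (u, v) p)) = weight p"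
proof (cases "P p")
  case False
  then have "\<not> P (insert (u, v) p)" for v using P_antimono by blast
  with False show ?thesis by (simp add: weight_def)
next
  case p: True
  show ?thesis
  proof (cases "u \<in> Domain p")
    case True
    then obtain b where b: "(u, b) \<in> p" by blast
    have "weight (insert (u, v) p) = (if v = b then weight p else 0)" for v
    proof (cases "v = b")
      case False
      then have "\<not> P (insert (u, v) p)" using P_functional[of "insert (u, v) p" u v b] b by auto
      with False show ?thesis by (simp add: weight_def)
    qed (use b in \<open>simp add: insert_absorb\<close>)
    then show ?thesis by simp
  next
    case False
    have "card (insert (u, v) p) \<le> Suc k" for v
      using assms by (simp add: card_insert_if)
    then have "(\<Sum>v\<in>UNIV. weight (insert (u, v) p)) =
        (\<Sum>v\<in>UNIV. if P (insert (u, v) p) then 1 / (num_on (Domain p) * num_ext u p) else 0)"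
      using num_on_insert[OF p assms False]
      by (intro sum.cong refl) (simp add: weight_def)
    also have "\<dots> = num_ext u p * (1 / (num_on (Domain p) * num_ext u p))"
      by (simp add: sum.If_cases num_ext_def)
    also have "\<dots> = weight p"
      using num_ext_pos[OF p assms, of u] p assms by (simp add: weight_def)
    finally show ?thesis .
  qed
qed

text \<open>By \<open>P_comp\<close> the pairs (a, b) that extend p form a disjoint union of blocks
  A x B, and \<psi> maps each A onto its B. So the block of (u, v) is square: v has as many
  preimages as u has images. This is one of the two inequalities; the other comes from the converse
  system.\<close>

lemma num_ext_le_converse:
  assumes "P (insert (u, v) p)" "card p \<le> k"
  shows "num_ext u p \<le> card {a. P (insert (a, v) p)}"
proof -
  have p: "P p" using assms(1) P_antimono by blast
  obtain \<psi> where \<psi>: "bij \<psi>" "\<And>a. P (insert (a, \<psi> a) p)"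
    using P_extend[OF p assms(2)] by blast
  have "P (insert (inv \<psi> b, v) p)" if b: "P (insert (u, b) p)" for b
  proof -
    define a where "a = inv \<psi> b"
    have a: "\<psi> a = b" using \<psi>(1) by (simp add: a_def bij_is_surj surj_f_inv_f)
    have "P (insert (a, b) p O (insert (u, b) p)\<inverse> O insert (u, v) p)"
      using P_comp[OF \<psi>(2)[of a] b assms(1)] a by simp
    moreover have "insert (a, v) p \<subseteq> insert (a, b) p O (insert (u, b) p)\<inverse> O insert (u, v) p"
    proof -
      have "p \<subseteq> p O p\<inverse> O p" by (auto intro!: relcompI)
      also have "\<dots> \<subseteq> insert (a, b) p O (insert (u, b) p)\<inverse> O insert (u, v) p"
        by (intro relcomp_mono) auto
      finally show ?thesis by blast
    qed
    ultimately show ?thesis unfolding a_def[symmetric] by (rule P_antimono)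
  qed
  then show ?thesis
    unfolding num_ext_def
    using bij_is_inj[OF bij_imp_bij_inv[OF \<psi>(1)]]
    by (intro card_inj_on_le[where f = "inv \<psi>"]) (auto intro: inj_on_subset)
qed

lemma num_ext_converse:
  assumes "P (insert (u, v) p)" "card p \<le> k"
  shows "partial_iso_system.num_ext (\<lambda>p. P (p\<inverse>)) v (p\<inverse>) = num_ext u p"
proof -
  interpret conv: partial_iso_system k "\<lambda>p. P (p\<inverse>)"
    by (rule partial_iso_system_converse)
  have "conv.num_ext v (p\<inverse>) \<le> num_ext u p"
    using conv.num_ext_le_converse[of v u "p\<inverse>"] assms by (simp add: converse_insert num_ext_def)
  moreover have "num_ext u p \<le> conv.num_ext v (p\<inverse>)"
    using num_ext_le_converse[OF assms] by (simp add: converse_insert conv.num_ext_def)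
  ultimately show ?thesis by simp
qed

text \<open>Adding a pair multiplies both counts by the same factor, by \<open>num_on_insert\<close>
  on either side and \<open>num_ext_converse\<close>. This makes the weight symmetric, whence the
  column equations.\<close>

lemma num_on_converse:
  assumes "P p" "card p \<le> Suc k"
  shows "partial_iso_system.num_on (\<lambda>p. P (p\<inverse>)) (Range p) = num_on (Domain p)"
proof -
  interpret conv: partial_iso_system k "\<lambda>p. P (p\<inverse>)"
    by (rule partial_iso_system_converse)
  have "finite p" by simp
  then show ?thesis using assms
  proof (induction p rule: finite_induct)
    case empty
    have "{q. P q \<and> Domain q = {}} = {{}}" "{q. P (q\<inverse>) \<and> Domain q = {}} = {{}}"
      using P_empty by (auto simp: Domain_empty_iff)
    then show ?case by (simp add: num_on_def conv.num_on_def)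
  next
    case (insert x p)
    obtain u v where x: "x = (u, v)" by (cases x)
    have p: "P p" "card p \<le> k"
      using insert P_antimono[of "insert x p" p] by auto
    have P: "P (insert (u, v) p)" using insert.prems x by simp
    have "u \<notin> Domain p"
      using P_functional[OF P, of u v] insert.hyps x by auto
    moreover have "v \<notin> Domain (p\<inverse>)"
      using P_injective[OF P, of u v] insert.hyps x by auto
    ultimately show ?case
      using num_on_insert[of p u] conv.num_on_insert[of "p\<inverse>" v] p insert.IH
        num_ext_converse[OF P p(2)]
      by (simp add: x)
  qed
qed

lemma weight_converse: "partial_iso_system.weight k (\<lambda>p. P (p\<inverse>)) (p\<inverse>) = weight p"
proof -
  interpret conv: partial_iso_system k "\<lambda>p. P (p\<inverse>)"
    by (rule partial_iso_system_converse)
  show ?thesis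
    using num_on_converse[of p] by (simp add: conv.weight_def weight_def)
qed

lemma weight_column:
  assumes "card p \<le> k"
  shows "(\<Sum>u\<in>UNIV. weight (insert (u, v) p)) = weight p"
proof -
  interpret conv: partial_iso_system k "\<lambda>p. P (p\<inverse>)"
    by (rule partial_iso_system_converse)
  show ?thesis
    using conv.weight_row[of "p\<inverse>" v] assms
    by (simp add: weight_converse flip: converse_insert)
qed

lemma weight_pos_iff: "card p \<le> Suc k \<Longrightarrow> 0 < weight p \<longleftrightarrow> P p"
  using num_on_pos by (simp add: weight_def)

lemma feasible_weight:
  assumes "\<And>p a b c d. P p \<Longrightarrow> (a, c) \<in> p \<Longrightarrow> (b, d) \<in> p \<Longrightarrow> {a, b} \<in> E \<longleftrightarrow> {c, d} \<in> F"
  shows "feasible k E F weight"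
proof -
  have "{q. P q \<and> Domain q = {}} = {{}}"
    using P_empty by (auto simp: Domain_empty_iff)
  then have "weight {} = 1"
    using P_empty by (simp add: weight_def num_on_def)
  moreover have "weight (insert (a, c) (insert (b, d) I)) = 0"
    if "{a, b} \<in> E \<longleftrightarrow> {c, d} \<notin> F" for a b c d I
    using assms[of "insert (a, c) (insert (b, d) I)" a c b d] that by (auto simp: weight_def)
  moreover have "0 \<le> weight I" for I by (simp add: weight_def)
  ultimately show ?thesis
    unfolding feasible_def using weight_row weight_column by blast
qed

end


section \<open>The coarsest bisimulation on tuples\<close>

text \<open>Such an R is a winning strategy in a bijective pebble game: the defender offers \<psi>,
  the attacker moves the i-th pebbles to w and \<open>\<psi> w\<close>. R relates tuples of two
  graphs and is not asked to be an equivalence.\<close>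

definition wl_bisim :: "nat \<Rightarrow> 'n set set \<Rightarrow> 'n set set \<Rightarrow> ('n list \<times> 'n list) set \<Rightarrow> bool" where
  "wl_bisim k E F R \<longleftrightarrow> (\<forall>(u, v)\<in>R. length u = k \<and> length v = k \<and> adj_matrix E u = adj_matrix F v \<and>
     (\<exists>\<psi>. bij \<psi> \<and> (\<forall>i<k. \<forall>w. (u[i := w], v[i := \<psi> w]) \<in> R)))"

definition wl_equiv :: "nat \<Rightarrow> 'n set set \<Rightarrow> 'n set set \<Rightarrow> ('n list \<times> 'n list) set" where
  "wl_equiv k E F = \<Union> {R. wl_bisim k E F R}"

lemma wl_bisimD:
  assumes "wl_bisim k E F R" "(u, v) \<in> R"
  shows "length u = k" "length v = k" "adj_matrix E u = adj_matrix F v"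
    and "\<exists>\<psi>. bij \<psi> \<and> (\<forall>i<k. \<forall>w. (u[i := w], v[i := \<psi> w]) \<in> R)"
  using assms by (auto simp: wl_bisim_def)

lemma wl_equiv_upper: "wl_bisim k E F R \<Longrightarrow> R \<subseteq> wl_equiv k E F"
  by (auto simp: wl_equiv_def)

lemma wl_bisim_wl_equiv: "wl_bisim k E F (wl_equiv k E F)"
  unfolding wl_bisim_def
proof clarify
  fix u v assume "(u, v) \<in> wl_equiv k E F"
  then obtain R where R: "wl_bisim k E F R" "(u, v) \<in> R" by (auto simp: wl_equiv_def)
  then show "length u = k \<and> length v = k \<and> adj_matrix E u = adj_matrix F v \<and>
     (\<exists>\<psi>. bij \<psi> \<and> (\<forall>i<k. \<forall>w. (u[i := w], v[i := \<psi> w]) \<in> wl_equiv k E F))"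
    using wl_bisimD[OF R] wl_equiv_upper[OF R(1)] by blast
qed

lemma wl_bisim_comp:
  assumes "wl_bisim k E F R" "wl_bisim k F G S"
  shows "wl_bisim k E G (R O S)"
  unfolding wl_bisim_def
proof clarify
  fix u v w assume R: "(u, v) \<in> R" and S: "(v, w) \<in> S"
  obtain \<psi> where \<psi>: "bij \<psi>" "\<forall>i<k. \<forall>w. (u[i := w], v[i := \<psi> w]) \<in> R"
    using wl_bisimD(4)[OF assms(1) R] by blast
  obtain \<psi>' where \<psi>': "bij \<psi>'" "\<forall>i<k. \<forall>x. (v[i := x], w[i := \<psi>' x]) \<in> S"
    using wl_bisimD(4)[OF assms(2) S] by blast
  have "bij (\<psi>' \<circ> \<psi>)" "\<forall>i<k. \<forall>x. (u[i := x], w[i := (\<psi>' \<circ> \<psi>) x]) \<in> R O S"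
    using bij_comp[OF \<psi>(1) \<psi>'(1)] relcompI[OF \<psi>(2)[rule_format] \<psi>'(2)[rule_format]] by auto
  then show "length u = k \<and> length w = k \<and> adj_matrix E u = adj_matrix G w \<and>
     (\<exists>\<psi>. bij \<psi> \<and> (\<forall>i<k. \<forall>x. (u[i := x], w[i := \<psi> x]) \<in> R O S))"
    using wl_bisimD(1-3)[OF assms(1) R] wl_bisimD(1-3)[OF assms(2) S] by auto
qed

lemma wl_bisim_converse:
  assumes "wl_bisim k E F R"
  shows "wl_bisim k F E (R\<inverse>)"
  unfolding wl_bisim_def
proof clarify
  fix u v assume R: "(u, v) \<in> R"
  obtain \<psi> where \<psi>: "bij \<psi>" "\<forall>i<k. \<forall>w. (u[i := w], v[i := \<psi> w]) \<in> R"
    using wl_bisimD(4)[OF assms(1) R] by blast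
  have "(v[i := w], u[i := inv \<psi> w]) \<in> R\<inverse>" if "i < k" for i w
    using \<psi>(2)[rule_format, OF that, of "inv \<psi> w"] \<psi>(1) by (simp add: bij_is_surj surj_f_inv_f)
  with \<psi>(1) show "length v = k \<and> length u = k \<and> adj_matrix F v = adj_matrix E u \<and>
     (\<exists>\<psi>. bij \<psi> \<and> (\<forall>i<k. \<forall>w. (v[i := w], u[i := \<psi> w]) \<in> R\<inverse>))"
    using wl_bisimD(1-3)[OF assms(1) R] by (auto intro!: exI[of _ "inv \<psi>"] bij_imp_bij_inv)
qed

text \<open>The zigzag of the largest bisimulation is a bisimulation again, hence contained in it;
  this becomes \<open>P_comp\<close>.\<close>

lemma wl_equiv_difunctional:
  assumes "(u, v) \<in> wl_equiv k E F" "(u', v) \<in> wl_equiv k E F" "(u', v') \<in> wl_equiv k E F"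
  shows "(u, v') \<in> wl_equiv k E F"
proof -
  let ?R = "wl_equiv k E F"
  have "wl_bisim k E F (?R O ?R\<inverse> O ?R)"
    using wl_bisim_comp[OF wl_bisim_wl_equiv wl_bisim_comp[OF wl_bisim_converse[OF wl_bisim_wl_equiv] wl_bisim_wl_equiv]] .
  from wl_equiv_upper[OF this] assms show ?thesis by blast
qed

section \<open>Bisimilarity depends on the set of pairs only\<close>

lemma insert_subset_set_update:
  assumes "Z \<subseteq> set l" "card Z < length l"
  obtains j where "j < length l" "\<And>x. insert x Z \<subseteq> set (l[j := x])"
proof -
  \<comment> \<open>Choose one occurrence for each element of Z; as Z has fewer elements than l has
    positions, some position is not chosen and may be overwritten.\<close>
  have "\<forall>z\<in>Z. \<exists>i<length l. l ! i = z" using assms(1) by (auto simp: in_set_conv_nth)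
  then obtain f where f: "\<And>z. z \<in> Z \<Longrightarrow> f z < length l" "\<And>z. z \<in> Z \<Longrightarrow> l ! f z = z"
    by metis
  have "finite Z" using assms(1) finite_subset by blast
  then have "card (f ` Z) < card {..<length l}"
    using assms(2) card_image_le[of Z f] by simp
  then obtain j where j: "j < length l" "j \<notin> f ` Z"
    by (metis \<open>finite Z\<close> card_mono finite_imageI lessThan_iff not_less subsetI)
  have "z \<in> set (l[j := x])" if "z \<in> Z" for x z
  proof -
    have "l[j := x] ! f z = z" using f[OF that] j that by (metis imageI nth_list_update_neq)
    then show ?thesis using f(1)[OF that] by (metis length_list_update nth_mem)
  qed
  then show thesis using j by (intro that[of j]) (auto simp: set_update_memI)
qed

text \<open>A pair of tuples is coded as one list of pairs, so that updates and reorderings act on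
  both tuples at once.\<close>

definition paired :: "('n list \<times> 'n list) set \<Rightarrow> ('n \<times> 'n) list \<Rightarrow> bool" where
  "paired R l \<longleftrightarrow> (map fst l, map snd l) \<in> R"

text \<open>\<open>?B\<close> collects all reorderings, repetitions and omissions of bisimilar
  tuples. It is a bisimulation: a move in l' keeps at most k - 1 old pairs, so l has a position to
  spare for the same move.\<close>

lemma wl_equiv_reindex:
  assumes "paired (wl_equiv k E F) l" "length l' = k" "set l' \<subseteq> set l"
  shows "paired (wl_equiv k E F) l'"
proof -
  let ?R = "wl_equiv k E F"
  let ?B = "{(map fst l', map snd l') | l l'. paired ?R l \<and> length l' = length l \<and> set l' \<subseteq> set l}"
  have "wl_bisim k E F ?B"
    unfolding wl_bisim_def
  proof clarify
    fix l l' :: "('a \<times> 'a) list"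
    assume l: "paired ?R l" and "length l' = length l" and sub: "set l' \<subseteq> set l"
    note D = wl_bisimD[OF wl_bisim_wl_equiv l[unfolded paired_def]]
    have len: "length l = k" using D by simp
    with \<open>length l' = length l\<close> sub have l': "length l' = k" "set l' \<subseteq> set l" by simp_all
    have "adj_matrix E (map fst l') = adj_matrix F (map snd l')"
      unfolding adj_matrix_eq_iff length_map
    proof (intro conjI refl, intro allI impI)
      fix i j assume ij: "i < length l'" "j < length l'"
      then obtain i' j' where "i' < length l" "l' ! i = l ! i'" "j' < length l" "l' ! j = l ! j'"
        using l'(2) by (metis in_set_conv_nth nth_mem subsetD)
      with D(3) ij show "(map fst l' ! i = map fst l' ! j \<longleftrightarrow> map snd l' ! i = map snd l' ! j) \<and>
        (map fst l' ! i \<noteq> map fst l' ! j \<longrightarrow> ({map fst l' ! i, map fst l' ! j} \<in> E \<longleftrightarrow>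
         {map snd l' ! i, map snd l' ! j} \<in> F))"
        unfolding adj_matrix_eq_iff by auto
    qed
    moreover obtain \<psi> where \<psi>: "bij \<psi>" "\<And>i w. i < k \<Longrightarrow> paired ?R (l[i := (w, \<psi> w)])"
      using D(4) by (auto simp: paired_def map_update)
    have "((map fst l')[i := w], (map snd l')[i := \<psi> w]) \<in> ?B" if i: "i < k" for i w
    proof -
      let ?Z = "set (take i l' @ drop (Suc i) l')"
      have "card ?Z < length l"
        using card_length[of "take i l' @ drop (Suc i) l'"] i len l'(1) by simp
      moreover have "?Z \<subseteq> set l"
        using l'(2) set_take_subset[of i l'] set_drop_subset[of "Suc i" l'] by auto
      ultimately obtain j where j: "j < length l" "\<And>x. insert x ?Z \<subseteq> set (l[j := x])"
        using insert_subset_set_update by blast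
      have "set (l'[i := (w, \<psi> w)]) \<subseteq> set (l[j := (w, \<psi> w)])"
        using j(2)[of "(w, \<psi> w)"] i l'(1) by (simp add: upd_conv_take_nth_drop)
      moreover have "paired ?R (l[j := (w, \<psi> w)])" using \<psi>(2) j(1) len by simp
      ultimately show ?thesis
        using l'(1) len
        by (intro CollectI exI[of _ "l[j := (w, \<psi> w)]"] exI[of _ "l'[i := (w, \<psi> w)]"])
          (simp add: map_update)
    qed
    ultimately show "length (map fst l') = k \<and> length (map snd l') = k \<and>
        adj_matrix E (map fst l') = adj_matrix F (map snd l') \<and>
        (\<exists>\<psi>. bij \<psi> \<and> (\<forall>i<k. \<forall>w. ((map fst l')[i := w], (map snd l')[i := \<psi> w]) \<in> ?B))"
      using \<psi>(1) l'(1) by auto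
  qed
  note B = wl_equiv_upper[OF this]
  have "length l = k"
    using wl_bisimD(1)[OF wl_bisim_wl_equiv assms(1)[unfolded paired_def]] by simp
  then show ?thesis using B assms unfolding paired_def by blast
qed

definition wl_partial_iso :: "nat \<Rightarrow> 'n set set \<Rightarrow> 'n set set \<Rightarrow> ('n \<times> 'n) set \<Rightarrow> bool" where
  "wl_partial_iso k E F p \<longleftrightarrow> (\<forall>l. length l = k \<and> set l \<subseteq> p \<longrightarrow> paired (wl_equiv k E F) l)"

lemma wl_partial_iso_set:
  "length l = k \<Longrightarrow> wl_partial_iso k E F (set l) \<longleftrightarrow> paired (wl_equiv k E F) l"
  unfolding wl_partial_iso_def using wl_equiv_reindex by blast

lemma wl_partial_iso_pair:
  assumes "wl_partial_iso k E F p" "k > 1" "(a, c) \<in> p" "(b, d) \<in> p"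
  shows "a = b \<longleftrightarrow> c = d" "a \<noteq> b \<Longrightarrow> {a, b} \<in> E \<longleftrightarrow> {c, d} \<in> F"
proof -
  \<comment> \<open>Both pairs fit into one tuple as k > 1; the second is repeated to reach length
    k.\<close>
  let ?l = "(a, c) # replicate (k - 1) (b, d)"
  have "paired (wl_equiv k E F) ?l"
    using assms by (auto simp: wl_partial_iso_def)
  from wl_bisimD(3)[OF wl_bisim_wl_equiv this[unfolded paired_def]] \<open>k > 1\<close>
  have "(map fst ?l ! 0 = map fst ?l ! 1 \<longleftrightarrow> map snd ?l ! 0 = map snd ?l ! 1) \<and>
      (map fst ?l ! 0 \<noteq> map fst ?l ! 1 \<longrightarrow>
        ({map fst ?l ! 0, map fst ?l ! 1} \<in> E \<longleftrightarrow> {map snd ?l ! 0, map snd ?l ! 1} \<in> F))"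
    unfolding adj_matrix_eq_iff by (metis One_nat_def Suc_lessD length_map length_Cons length_replicate Suc_pred)
  then have "(a = b \<longleftrightarrow> c = d) \<and> (a \<noteq> b \<longrightarrow> ({a, b} \<in> E \<longleftrightarrow> {c, d} \<in> F))"
    using \<open>k > 1\<close> by simp
  then show "a = b \<longleftrightarrow> c = d" "a \<noteq> b \<Longrightarrow> {a, b} \<in> E \<longleftrightarrow> {c, d} \<in> F" by auto
qed

lemma partial_iso_system_wl:
  fixes E F :: "'n::finite set set"
  assumes k: "k > 1" and ne: "wl_equiv k E F \<noteq> {}"
  shows "partial_iso_system k (wl_partial_iso k E F)"
proof
  show "wl_partial_iso k E F {}" using k by (auto simp: wl_partial_iso_def)
  show "wl_partial_iso k E F q" if "wl_partial_iso k E F p" "q \<subseteq> p" for p q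
    using that unfolding wl_partial_iso_def by blast
  show "b = c" if "wl_partial_iso k E F p" "(a, b) \<in> p" "(a, c) \<in> p" for p a b c
    using wl_partial_iso_pair(1)[OF that(1) k that(2,3)] by simp
  show "a = b" if "wl_partial_iso k E F p" "(a, c) \<in> p" "(b, c) \<in> p" for p a b c
    using wl_partial_iso_pair(1)[OF that(1) k that(2,3)] by simp
next
  fix p q r assume P: "wl_partial_iso k E F p" "wl_partial_iso k E F q" "wl_partial_iso k E F r"
  show "wl_partial_iso k E F (p O q\<inverse> O r)"
    unfolding wl_partial_iso_def paired_def
  proof clarify
    fix l assume l: "k = length l" "set l \<subseteq> p O q\<inverse> O r"
    \<comment> \<open>Intermediate vertices are chosen for each entry of l; this gives three lists,
      in p, q and r, to which difunctionality applies.\<close>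
    then have "\<forall>x\<in>set l. \<exists>b a. (fst x, b) \<in> p \<and> (a, b) \<in> q \<and> (a, snd x) \<in> r" by fastforce
    then obtain f g where fg: "\<And>x. x \<in> set l \<Longrightarrow> (fst x, f x) \<in> p \<and> (g x, f x) \<in> q \<and> (g x, snd x) \<in> r"
      by metis
    have "paired (wl_equiv k E F) (map (\<lambda>x. (fst x, f x)) l)"
      by (rule P(1)[unfolded wl_partial_iso_def, rule_format]) (use l(1) fg in auto)
    moreover have "paired (wl_equiv k E F) (map (\<lambda>x. (g x, f x)) l)"
      by (rule P(2)[unfolded wl_partial_iso_def, rule_format]) (use l(1) fg in auto)
    moreover have "paired (wl_equiv k E F) (map (\<lambda>x. (g x, snd x)) l)"
      by (rule P(3)[unfolded wl_partial_iso_def, rule_format]) (use l(1) fg in auto)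
    ultimately show "(map fst l, map snd l) \<in> wl_equiv (length l) E F"
      using wl_equiv_difunctional[of "map fst l" "map f l" k E F "map g l" "map snd l"] l(1)
      by (simp add: paired_def comp_def)
  qed
next
  fix p assume P: "wl_partial_iso k E F p" and c: "card p \<le> k"
  \<comment> \<open>A nonempty p is padded by repeating one of its pairs. An empty p has none to
    repeat, and \<open>ne\<close> supplies some bisimilar tuples instead.\<close>
  obtain l where l: "length l = k" "paired (wl_equiv k E F) l" "p \<subseteq> set l"
  proof (cases "p = {}")
    case True
    obtain u v where uv: "(u, v) \<in> wl_equiv k E F" using ne by auto
    note D = wl_bisimD[OF wl_bisim_wl_equiv this]
    show thesis
      using uv D(1,2) True by (intro that[of "zip u v"]) (auto simp: paired_def)
  next
    case False
    then obtain x where x: "x \<in> p" by auto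
    obtain xs where xs: "set xs = p" "distinct xs" using finite_distinct_list[of p] by auto
    let ?l = "xs @ replicate (k - card p) x"
    have "length ?l = k" using c xs distinct_card[of xs] by simp
    moreover have "set ?l = p" using xs x by auto
    ultimately show thesis
      using P by (intro that[of ?l]) (auto simp: wl_partial_iso_def)
  qed
  note D = wl_bisimD[OF wl_bisim_wl_equiv l(2)[unfolded paired_def]]
  obtain \<psi> where \<psi>: "bij \<psi>" "\<And>i w. i < k \<Longrightarrow> paired (wl_equiv k E F) (l[i := (w, \<psi> w)])"
    using D(4) by (auto simp: paired_def map_update)
  have "wl_partial_iso k E F (insert (a, \<psi> a) p)" for a
    unfolding wl_partial_iso_def
  proof clarify
    fix l' assume l': "k = length l'" "set l' \<subseteq> insert (a, \<psi> a) p"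
    show "paired (wl_equiv (length l') E F) l'"
    proof (cases "(a, \<psi> a) \<in> set l'")
      case False
      then show ?thesis using P l' unfolding wl_partial_iso_def by blast
    next
      case True
      \<comment> \<open>At most k - 1 distinct entries of l' are old pairs, so some position of l
        can take the new pair while all of them stay.\<close>
      let ?Z = "set l' - {(a, \<psi> a)}"
      have "card ?Z < card (set l')" using True by (intro card_Diff1_less) auto
      then have "card ?Z < length l" using card_length[of l'] l(1) l'(1) by simp
      moreover have "?Z \<subseteq> set l" using l' l(3) by auto
      ultimately obtain j where j: "j < length l" "\<And>x. insert x ?Z \<subseteq> set (l[j := x])"
        using insert_subset_set_update by blast
      have "set l' \<subseteq> set (l[j := (a, \<psi> a)])" using j(2)[of "(a, \<psi> a)"] by auto
      moreover have "j < k" using j(1) l(1) by simp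
      ultimately show ?thesis
        unfolding l'(1)[symmetric] using wl_equiv_reindex[OF \<psi>(2)] l'(1)[symmetric] by blast
    qed
  qed
  with \<psi>(1) show "\<exists>\<psi>. bij \<psi> \<and> (\<forall>a. wl_partial_iso k E F (insert (a, \<psi> a) p))" by blast
qed

lemma feasible_of_wl_equiv:
  fixes E F :: "'n::finite set set"
  assumes k: "k > 1" and ne: "wl_equiv k E F \<noteq> {}" and sg: "simple_graph E" "simple_graph F"
  obtains z where "feasible k E F z" "\<And>u v. (u, v) \<in> wl_equiv k E F \<Longrightarrow> 0 < z (set (zip u v))"
proof -
  interpret partial_iso_system k "wl_partial_iso k E F"
    by (rule partial_iso_system_wl[OF k ne])
  \<comment> \<open>An adjacency matrix shows 0 at equal entries and says nothing about loops;
    simplicity of both graphs settles the case a = b.\<close>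
  have loop: "{a} \<notin> E" "{a} \<notin> F" for a
    using sg[unfolded simple_graph_def, THEN bspec, of "{a}"] by auto
  have "feasible k E F weight"
  proof (rule feasible_weight)
    fix p a b c d assume *: "wl_partial_iso k E F p" "(a, c) \<in> p" "(b, d) \<in> p"
    show "{a, b} \<in> E \<longleftrightarrow> {c, d} \<in> F"
      using wl_partial_iso_pair[OF *(1) k *(2,3)] loop by (cases "a = b") auto
  qed
  moreover have "0 < weight (set (zip u v))" if "(u, v) \<in> wl_equiv k E F" for u v
  proof -
    note D = wl_bisimD[OF wl_bisim_wl_equiv that]
    have "wl_partial_iso k E F (set (zip u v))"
      using that D(1,2) by (subst wl_partial_iso_set) (auto simp: paired_def)
    moreover have "card (set (zip u v)) \<le> Suc k"
      using card_set_zip_le[OF D(1), of v] by simp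
    ultimately show ?thesis by (simp add: weight_pos_iff)
  qed
  ultimately show thesis by (rule that)
qed


section \<open>Iteration until stable\<close>

text \<open>Any stable stage will do, since nothing changes after the first one, where the loop
  stops.\<close>

lemma iterate_until_stable_eq_funpow:
  assumes "f ((f ^^ n) x) = (f ^^ n) x"
  shows "iterate_until_stable f x = (f ^^ n) x"
  using assms
proof (induction n arbitrary: x)
  case 0
  then show ?case by (simp add: iterate_until_stable_def while_unfold)
next
  case (Suc n)
  show ?case
  proof (cases "f x = x")
    case True
    then have "(f ^^ m) x = x" for m by (induction m) simp_all
    with True show ?thesis by (subst iterate_until_stable_def, subst while_unfold) simp
  next
    case False
    then have "iterate_until_stable f x = iterate_until_stable f (f x)"
      unfolding iterate_until_stable_def by (subst while_unfold) simp
    with Suc show ?thesis by (simp add: funpow_swap1)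
  qed
qed

text \<open>The refinements of two graphs may stabilise at different times; this allows a comparison
  at a common stage.\<close>

lemma iterate_until_stable_eventually:
  assumes "f ((f ^^ n) x) = (f ^^ n) x" "n \<le> m"
  shows "iterate_until_stable f x = (f ^^ m) x"
proof -
  have "f ((f ^^ m) x) = (f ^^ m) x"
    using assms(2,1) by (induction m rule: dec_induct) simp_all
  then show ?thesis by (rule iterate_until_stable_eq_funpow)
qed

lemma ascending_chain_stops:
  fixes S :: "nat \<Rightarrow> 'a set"
  assumes "finite B" "\<And>j. S j \<subseteq> B" "\<And>j. S j \<subseteq> S (Suc j)"
  obtains j where "S (Suc j) = S j"
proof (rule ccontr)
  assume "\<not> thesis"
  then have strict: "S j \<subset> S (Suc j)" for j using that assms(3)[of j] by auto
  have "j \<le> card (S j)" for j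
  proof (induction j)
    case (Suc j)
    then show ?case
      using psubset_card_mono[OF finite_subset[OF assms(2,1)] strict[of j]] by simp
  qed simp
  from this[of "Suc (card B)"] card_mono[OF assms(1) assms(2)[of "Suc (card B)"]] show False by simp
qed

lemma finite_tuples: "finite (tuples k :: 'n::finite list set)"
  unfolding tuples_def using finite_lists_length_eq[of "UNIV :: 'n set" k] by simp


section \<open>Colourings compatible with a feasible point\<close>

text \<open>M vanishes between different colours. Its mass on the block of colour c is therefore the
  size of \<open>?A\<close> when summed by rows and the size of \<open>?B\<close> when summed by
  columns.\<close>

lemma stochastic_image_mset_eq:
  fixes M :: "'a \<Rightarrow> 'b \<Rightarrow> real"
  assumes fin: "finite A" "finite B" and nonneg: "\<And>a b. a \<in> A \<Longrightarrow> b \<in> B \<Longrightarrow> 0 \<le> M a b"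
    and row: "\<And>a. a \<in> A \<Longrightarrow> (\<Sum>b\<in>B. M a b) = 1" and col: "\<And>b. b \<in> B \<Longrightarrow> (\<Sum>a\<in>A. M a b) = 1"
    and compat: "\<And>a b. a \<in> A \<Longrightarrow> b \<in> B \<Longrightarrow> 0 < M a b \<Longrightarrow> f a = g b"
  shows "image_mset f (mset_set A) = image_mset g (mset_set B)"
proof (rule multiset_eqI)
  fix c
  let ?A = "{a \<in> A. f a = c}" and ?B = "{b \<in> B. g b = c}"
  have nonzero: "f a = g b" if "a \<in> A" "b \<in> B" "M a b \<noteq> 0" for a b
    using nonneg[of a b] compat[of a b] that by force
  have "real (card ?A) = (\<Sum>a\<in>?A. \<Sum>b\<in>B. M a b)" using row by simp
  also have "\<dots> = (\<Sum>a\<in>?A. \<Sum>b\<in>?B. M a b)"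
    using fin by (intro sum.cong[OF refl] sum.mono_neutral_right) (auto dest: nonzero)
  also have "\<dots> = (\<Sum>b\<in>?B. \<Sum>a\<in>?A. M a b)" by (rule sum.swap)
  also have "\<dots> = (\<Sum>b\<in>?B. \<Sum>a\<in>A. M a b)"
    using fin by (intro sum.cong[OF refl] sum.mono_neutral_left) (auto dest: nonzero)
  also have "\<dots> = real (card ?B)" using col by simp
  finally show "count (image_mset f (mset_set A)) c = count (image_mset g (mset_set B)) c"
    using fin by (simp add: count_image_mset_eq_card_vimage)
qed

lemma tuples_0: "tuples 0 = {[]}"
  by (auto simp: tuples_def)

lemma tuples_Suc: "tuples (Suc m) = (\<lambda>(a, v). a # v) ` (UNIV \<times> tuples m)"
  by (auto simp: tuples_def length_Suc_conv image_iff)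

text \<open>The row equations sum out one entry at a time. With m = k and I empty,
  \<open>z (set (zip u v))\<close> becomes a stochastic matrix on k-tuples.\<close>

lemma feasible_sum_tuples:
  assumes "feasible k E F z" "length u = m" "card I + m \<le> Suc k"
  shows "(\<Sum>v\<in>tuples m. z (set (zip u v) \<union> I)) = z I"
  using assms(2,3)
proof (induction u arbitrary: m I)
  case Nil
  then show ?case by (simp add: tuples_0)
next
  case (Cons a u)
  then obtain m' where m: "m = Suc m'" "length u = m'" by auto
  have "(\<Sum>v\<in>tuples m. z (set (zip (a # u) v) \<union> I)) =
      (\<Sum>b\<in>UNIV. \<Sum>v\<in>tuples m'. z (set (zip u v) \<union> insert (a, b) I))"
    unfolding m tuples_Suc
    by (subst sum.reindex) (auto simp: inj_on_def sum.cartesian_product intro!: sum.cong)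
  also have "\<dots> = (\<Sum>b\<in>UNIV. z (insert (a, b) I))"
    using Cons.prems m by (intro sum.cong refl Cons.IH) (auto simp: card_insert_if)
  also have "\<dots> = z I"
    using Cons.prems m by (intro feasibleD(3)[OF assms(1)]) auto
  finally show ?case .
qed

lemma converse_set_zip: "length u = length v \<Longrightarrow> (set (zip u v))\<inverse> = set (zip v u)"
  by (auto simp: in_set_zip)

lemma feasible_tuples_image_mset:
  fixes f :: "'n::finite list \<Rightarrow> 'c"
  assumes z: "feasible k E F z"
    and compat: "\<And>u v. u \<in> tuples k \<Longrightarrow> v \<in> tuples k \<Longrightarrow> 0 < z (set (zip u v)) \<Longrightarrow> f u = g v"
  shows "image_mset f (mset_set (tuples k)) = image_mset g (mset_set (tuples k))"
proof (rule stochastic_image_mset_eq[where M = "\<lambda>u v. z (set (zip u v))"])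
  fix u v :: "'n list" assume uv: "u \<in> tuples k" "v \<in> tuples k"
  then show "0 \<le> z (set (zip u v))"
    using card_set_zip_le[of u k v] by (intro feasibleD(2)[OF z]) (simp add: tuples_def)
next
  fix u :: "'n list" assume "u \<in> tuples k"
  then show "(\<Sum>v\<in>tuples k. z (set (zip u v))) = 1"
    using feasible_sum_tuples[OF z, of u k "{}"] feasibleD(1)[OF z] by (simp add: tuples_def)
next
  fix v :: "'n list" assume v: "v \<in> tuples k"
  then have "(\<Sum>u\<in>tuples k. z ((set (zip v u))\<inverse>)) = 1"
    using feasible_sum_tuples[OF feasible_converse[OF z], of v k "{}"] feasibleD(1)[OF z]
    by (simp add: tuples_def)
  moreover have "(\<Sum>u\<in>tuples k. z (set (zip u v))) = (\<Sum>u\<in>tuples k. z ((set (zip v u))\<inverse>))"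
    using v by (intro sum.cong refl) (simp add: tuples_def converse_set_zip)
  ultimately show "(\<Sum>u\<in>tuples k. z (set (zip u v))) = 1" by simp
qed (use compat finite_tuples in auto)

lemma feasible_extension_image_mset:
  fixes f :: "'n::finite \<Rightarrow> 'c"
  assumes z: "feasible k E F z" and I: "card I \<le> k" "0 < z I"
    and compat: "\<And>a b. 0 < z (insert (a, b) I) \<Longrightarrow> f a = g b"
  shows "image_mset f (mset_set UNIV) = image_mset g (mset_set UNIV)"
proof (rule stochastic_image_mset_eq[where M = "\<lambda>a b. z (insert (a, b) I) / z I"])
  show "0 \<le> z (insert (a, b) I) / z I" for a b
    using I by (intro divide_nonneg_pos feasibleD(2)[OF z]) (auto simp: card_insert_if)
  show "(\<Sum>b\<in>UNIV. z (insert (a, b) I) / z I) = 1" for a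
    using feasibleD(3)[OF z I(1)] I(2) by (simp flip: sum_divide_distrib)
  show "(\<Sum>a\<in>UNIV. z (insert (a, b) I) / z I) = 1" for b
    using feasibleD(4)[OF z I(1)] I(2) by (simp flip: sum_divide_distrib)
qed (use compat I in \<open>auto simp: zero_less_divide_iff\<close>)

text \<open>Level k + 1 is needed here: the k old pairs and the new one form a single set, of which
  the updated tuples form a subset.\<close>

lemma feasible_update_pos:
  assumes z: "feasible k E F z" and uv: "length u = k" "length v = k" and i: "i < k"
    and pos: "0 < z (insert (a, b) (set (zip u v)))"
  shows "0 < z (set (zip (u[i := a]) (v[i := b])))"
proof -
  have "card (insert (a, b) (set (zip u v))) \<le> Suc k"
    using card_set_zip_le[OF uv(1), of v] by (simp add: card_insert_if)
  moreover have "set (zip (u[i := a]) (v[i := b])) \<subseteq> insert (a, b) (set (zip u v))"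
    by (metis set_update_subset_insert zip_update)
  ultimately show ?thesis
    using feasible_antimono[OF z] pos less_le_trans by metis
qed

text \<open>Instead of extracting a permutation from a doubly stochastic matrix, it suffices that the
  matrix is block diagonal with respect to the colours.\<close>

lemma feasible_refine_colours:
  fixes f :: "'n::finite list \<Rightarrow> 'c"
  assumes z: "feasible k E F z" and uv: "length u = k" "length v = k" "0 < z (set (zip u v))"
    and compat: "\<And>u v. length u = k \<Longrightarrow> length v = k \<Longrightarrow> 0 < z (set (zip u v)) \<Longrightarrow> f u = g v"
  shows "image_mset (\<lambda>w. map (\<lambda>i. f (u[i := w])) [0..<k]) (mset_set UNIV) =
    image_mset (\<lambda>w. map (\<lambda>i. g (v[i := w])) [0..<k]) (mset_set UNIV)"
proof (rule feasible_extension_image_mset[OF z card_set_zip_le[OF uv(1)] uv(3)])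
  fix a b assume "0 < z (insert (a, b) (set (zip u v)))"
  then show "map (\<lambda>i. f (u[i := a])) [0..<k] = map (\<lambda>i. g (v[i := b])) [0..<k]"
    using feasible_update_pos[OF z uv(1,2)] uv by (auto intro!: compat)
qed

lemma bij_of_image_mset_eq:
  fixes f g :: "'n::finite \<Rightarrow> 'c"
  assumes "image_mset f (mset_set UNIV) = image_mset g (mset_set UNIV)"
  obtains \<psi> where "bij \<psi>" "\<And>w. f w = g (\<psi> w)"
  using image_mset_eq_implies_permutes[OF _ assms] permutes_bij by (metis UNIV_I finite)


section \<open>The automorphism version\<close>

lemma wl_aut_refine_subset: "wl_aut_refine k R \<subseteq> R"
  by (auto simp: wl_aut_refine_def)

lemma wl_aut_properties:
  fixes E :: "'n::finite set set"
  obtains n where "wl_aut k E = (wl_aut_refine k ^^ n) (wl_aut_init k E)"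
    and "wl_aut_refine k (wl_aut k E) = wl_aut k E"
proof -
  let ?\<pi> = "\<lambda>n. (wl_aut_refine k ^^ n) (wl_aut_init k E)"
  let ?T = "tuples k \<times> tuples k :: ('n list \<times> 'n list) set"
  have sub: "?\<pi> n \<subseteq> ?T" for n
    using wl_aut_refine_subset by (induction n) (fastforce simp: wl_aut_init_def)+
  \<comment> \<open>The relations shrink, so their complements ascend.\<close>
  obtain j where "?T - ?\<pi> (Suc j) = ?T - ?\<pi> j"
  proof (rule ascending_chain_stops[of ?T "\<lambda>j. ?T - ?\<pi> j"])
    show "?T - ?\<pi> j \<subseteq> ?T - ?\<pi> (Suc j)" for j
      using wl_aut_refine_subset[of k "?\<pi> j"] by auto
  qed (auto simp: finite_tuples)
  then have "?\<pi> (Suc j) = ?\<pi> j" using sub[of j] sub[of "Suc j"] by blast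
  then have "wl_aut_refine k (?\<pi> j) = ?\<pi> j" by simp
  with iterate_until_stable_eq_funpow[OF this] show thesis
    by (intro that[of j]) (simp_all add: wl_aut_def)
qed

lemma equiv_wl_aut_refine:
  fixes R :: "('n::finite list \<times> 'n list) set"
  assumes R: "equiv (tuples k) R"
  shows "equiv (tuples k) (wl_aut_refine k R)"
proof (rule equivI)
  show "wl_aut_refine k R \<subseteq> tuples k \<times> tuples k"
    using wl_aut_refine_subset[of k R] R by (auto simp: equiv_def refl_on_def)
  show "refl_on (tuples k) (wl_aut_refine k R)"
  proof (rule refl_onI)
    fix u :: "'n list" assume u: "u \<in> tuples k"
    then have "(u, u) \<in> R" "\<forall>i<k. \<forall>w. (u[i := w], u[i := id w]) \<in> R"
      using equiv_class_eq_iff[OF R] by (auto simp: tuples_def)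
    then show "(u, u) \<in> wl_aut_refine k R"
      unfolding wl_aut_refine_def using bij_id by blast
  qed
  show "sym (wl_aut_refine k R)"
  proof (rule symI)
    fix u v assume "(u, v) \<in> wl_aut_refine k R"
    then obtain \<psi> where \<psi>: "(u, v) \<in> R" "bij \<psi>" "\<And>i w. i < k \<Longrightarrow> (u[i := w], v[i := \<psi> w]) \<in> R"
      by (auto simp: wl_aut_refine_def)
    have "(v[i := w], u[i := inv \<psi> w]) \<in> R" if "i < k" for i w
      using \<psi>(3)[OF that, of "inv \<psi> w"] \<psi>(2) R by (auto simp: bij_is_surj surj_f_inv_f equiv_def dest: symD)
    then show "(v, u) \<in> wl_aut_refine k R"
      using \<psi>(1,2) R bij_imp_bij_inv[of \<psi>] unfolding wl_aut_refine_def equiv_def by (blast dest: symD)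
  qed
  show "trans (wl_aut_refine k R)"
  proof (rule transI)
    fix u v w assume "(u, v) \<in> wl_aut_refine k R" "(v, w) \<in> wl_aut_refine k R"
    then obtain \<psi> \<psi>' where \<psi>: "(u, v) \<in> R" "bij \<psi>" "\<And>i x. i < k \<Longrightarrow> (u[i := x], v[i := \<psi> x]) \<in> R"
      and \<psi>': "(v, w) \<in> R" "bij \<psi>'" "\<And>i x. i < k \<Longrightarrow> (v[i := x], w[i := \<psi>' x]) \<in> R"
      by (auto simp: wl_aut_refine_def)
    have "trans R" using R by (simp add: equiv_def)
    then have "(u, w) \<in> R" "\<forall>i<k. \<forall>x. (u[i := x], w[i := (\<psi>' \<circ> \<psi>) x]) \<in> R"
      using transD[OF \<open>trans R\<close> \<psi>(1) \<psi>'(1)] transD[OF \<open>trans R\<close> \<psi>(3) \<psi>'(3)] by auto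
    then show "(u, w) \<in> wl_aut_refine k R"
      using bij_comp[OF \<psi>(2) \<psi>'(2)] unfolding wl_aut_refine_def by blast
  qed
qed

lemma equiv_wl_aut_init: "equiv (tuples k) (wl_aut_init k E)"
  by (rule equivI) (auto simp: wl_aut_init_def refl_on_def sym_def trans_def)

lemma equiv_wl_aut: "equiv (tuples k) (wl_aut k (E :: 'n::finite set set))"
proof -
  obtain n where n: "wl_aut k E = (wl_aut_refine k ^^ n) (wl_aut_init k E)"
    by (rule wl_aut_properties)
  show ?thesis
    unfolding n by (induction n) (simp_all add: equiv_wl_aut_init equiv_wl_aut_refine)
qed

lemma wl_aut_bisim: "wl_bisim k E E (wl_aut k (E :: 'n::finite set set))"
proof -
  obtain n where n: "wl_aut k E = (wl_aut_refine k ^^ n) (wl_aut_init k E)"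
    and stable: "wl_aut_refine k (wl_aut k E) = wl_aut k E"
    by (rule wl_aut_properties)
  have sub: "wl_aut k E \<subseteq> wl_aut_init k E"
    unfolding n using wl_aut_refine_subset by (induction n) fastforce+
  show ?thesis
    unfolding wl_bisim_def
  proof clarify
    fix u v assume uv: "(u, v) \<in> wl_aut k E"
    then have "(u, v) \<in> wl_aut_refine k (wl_aut k E)" unfolding stable .
    with uv sub show "length u = k \<and> length v = k \<and> adj_matrix E u = adj_matrix E v \<and>
        (\<exists>\<psi>. bij \<psi> \<and> (\<forall>i<k. \<forall>w. (u[i := w], v[i := \<psi> w]) \<in> wl_aut k E))"
      by (auto simp: wl_aut_refine_def wl_aut_init_def tuples_def)
  qed
qed

text \<open>Each stage is an equivalence, so tuples can be coloured by their classes;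
  \<open>feasible_refine_colours\<close> then supplies the bijection that a refinement step asks
  for.\<close>

lemma feasible_wl_aut:
  fixes E :: "'n::finite set set"
  assumes z: "feasible k E E z" and k: "k > 1"
    and uv: "length u = k" "length v = k" "0 < z (set (zip u v))"
  shows "(u, v) \<in> wl_aut k E"
proof -
  have step: "(u, v) \<in> wl_aut_refine k R"
    if R: "equiv (tuples k) R"
      and le: "\<And>u v. length u = k \<Longrightarrow> length v = k \<Longrightarrow> 0 < z (set (zip u v)) \<Longrightarrow> (u, v) \<in> R"
      and uv: "length u = k" "length v = k" "0 < z (set (zip u v))" for R u v
  proof -
    have "image_mset (\<lambda>w. map (\<lambda>i. R `` {u[i := w]}) [0..<k]) (mset_set UNIV) =
        image_mset (\<lambda>w. map (\<lambda>i. R `` {v[i := w]}) [0..<k]) (mset_set UNIV)"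
      using le equiv_class_eq[OF R] by (intro feasible_refine_colours[OF z uv]) blast
    then obtain \<psi> where \<psi>: "bij \<psi>"
      "\<And>w. map (\<lambda>i. R `` {u[i := w]}) [0..<k] = map (\<lambda>i. R `` {v[i := \<psi> w]}) [0..<k]"
      using bij_of_image_mset_eq by blast
    have "(u[i := w], v[i := \<psi> w]) \<in> R" if "i < k" for i w
    proof -
      have "R `` {u[i := w]} = R `` {v[i := \<psi> w]}"
        using \<psi>(2)[of w] that by (simp add: map_eq_conv)
      then show ?thesis using uv by (subst equiv_class_eq_iff[OF R]) (simp add: tuples_def)
    qed
    then show ?thesis using \<psi>(1) le[OF uv] unfolding wl_aut_refine_def by blast
  qed
  obtain n where n: "wl_aut k E = (wl_aut_refine k ^^ n) (wl_aut_init k E)"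
    by (rule wl_aut_properties)
  have "equiv (tuples k) ((wl_aut_refine k ^^ n) (wl_aut_init k E)) \<and>
    (\<forall>u v. length u = k \<longrightarrow> length v = k \<longrightarrow> 0 < z (set (zip u v)) \<longrightarrow>
      (u, v) \<in> (wl_aut_refine k ^^ n) (wl_aut_init k E))"
  proof (induction n)
    case 0
    then show ?case
      using feasible_adj_matrix[OF z] k by (auto simp: equiv_wl_aut_init) (auto simp: wl_aut_init_def tuples_def)
  next
    case (Suc n)
    let ?R = "(wl_aut_refine k ^^ n) (wl_aut_init k E)"
    have "equiv (tuples k) (wl_aut_refine k ?R)"
      using Suc by (intro equiv_wl_aut_refine) blast
    moreover have "(u, v) \<in> wl_aut_refine k ?R"
      if "length u = k" "length v = k" "0 < z (set (zip u v))" for u v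
      by (rule step) (use Suc that in blast)+
    ultimately show ?case by simp
  qed
  with n uv show ?thesis by simp
qed

lemma wl_determines_asymmetric_iff:
  fixes E :: "'n::finite set set"
  shows "wl_determines_asymmetric k E \<longleftrightarrow> wl_aut k E \<subseteq> Id"
proof
  assume "wl_determines_asymmetric k E"
  show "wl_aut k E \<subseteq> Id"
  proof clarify
    fix u v assume uv: "(u, v) \<in> wl_aut k E"
    then have "u \<in> tuples k" using equiv_wl_aut[of k E] by (auto simp: equiv_def)
    then have "is_singleton (wl_aut k E `` {u})"
      using \<open>wl_determines_asymmetric k E\<close> by (auto simp: wl_determines_asymmetric_def quotient_def)
    then obtain x where "wl_aut k E `` {u} = {x}" by (auto simp: is_singleton_def)
    moreover have "u \<in> wl_aut k E `` {u}" "v \<in> wl_aut k E `` {u}"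
      using uv equiv_class_self[OF equiv_wl_aut \<open>u \<in> tuples k\<close>] by blast+
    ultimately show "u = v" by (metis singletonD)
  qed
next
  assume sub: "wl_aut k E \<subseteq> Id"
  have "wl_aut k E `` {u} = {u}" if "u \<in> tuples k" for u
    using sub equiv_class_self[OF equiv_wl_aut that, of E] by blast
  then show "wl_determines_asymmetric k E"
    unfolding wl_determines_asymmetric_def quotient_def is_singleton_def by blast
qed

lemma feasible_identity: "feasible k E E (\<lambda>p. if p \<subseteq> Id then 1 else 0)"
  by (auto simp: feasible_def sum.If_cases)

lemma mat_1_in_aut_relaxation: "mat 1 \<in> aut_relaxation (k + 1) E"
  unfolding Suc_eq_plus1[symmetric] iso_relaxation_iff_feasible
  using feasible_identity[of k E]
  by (intro exI[of _ "\<lambda>p. if p \<subseteq> Id then 1 else 0"]) (simp add: mat_def)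

lemma aut_relaxation_iff_wl:
  fixes E :: "'n::finite set set"
  assumes k: "k > 1" and E: "simple_graph E"
  shows "aut_relaxation (k + 1) E = {mat 1} \<longleftrightarrow> wl_determines_asymmetric k E"
proof
  assume triv: "aut_relaxation (k + 1) E = {mat 1}"
  have "u = v" if uv: "(u, v) \<in> wl_aut k E" for u v
  proof -
    have sub: "wl_aut k E \<subseteq> wl_equiv k E E" by (rule wl_equiv_upper[OF wl_aut_bisim])
    obtain z where z: "feasible k E E z" "\<And>u v. (u, v) \<in> wl_equiv k E E \<Longrightarrow> 0 < z (set (zip u v))"
      using feasible_of_wl_equiv[OF k _ E E] uv sub by blast
    have len: "length u = k" "length v = k" using wl_bisimD[OF wl_aut_bisim uv] by auto
    have "(\<chi> a b. z {(a, b)}) \<in> aut_relaxation (k + 1) E"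
      unfolding Suc_eq_plus1[symmetric] iso_relaxation_iff_feasible
      using z(1) by (intro exI[of _ z]) simp
    then have z1: "z {(a, b)} = (if a = b then 1 else 0)" for a b
      unfolding triv by (simp add: vec_eq_iff mat_def)
    have "u ! i = v ! i" if "i < k" for i
    proof -
      \<comment> \<open>Positivity on the whole set of pairs descends to each single pair, where z
        is the identity matrix.\<close>
      have "z (set (zip u v)) \<le> z {(u ! i, v ! i)}"
        using card_set_zip_le[OF len(1), of v] len that
        by (intro feasible_antimono[OF z(1)]) (auto simp: in_set_zip)
      with z(2)[OF subsetD[OF sub uv]] show ?thesis by (auto simp: z1 split: if_splits)
    qed
    with len show ?thesis by (simp add: list_eq_iff_nth_eq)
  qed
  then show "wl_determines_asymmetric k E" unfolding wl_determines_asymmetric_iff by auto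
next
  assume "wl_determines_asymmetric k E"
  then have triv: "wl_aut k E \<subseteq> Id" by (simp add: wl_determines_asymmetric_iff)
  have "X = mat 1" if X: "X \<in> aut_relaxation (k + 1) E" for X
  proof -
    obtain z where z: "feasible k E E z" and X: "\<And>u v. X $ u $ v = z {(u, v)}"
      using X unfolding Suc_eq_plus1[symmetric] iso_relaxation_iff_feasible by blast
    have off: "z {(a, b)} = 0" if "a \<noteq> b" for a b
    proof (rule ccontr)
      assume "z {(a, b)} \<noteq> 0"
      moreover have "0 \<le> z {(a, b)}" by (rule feasibleD(2)[OF z]) simp
      \<comment> \<open>A single pair is the set of pairs of two constant tuples.\<close>
      moreover have "set (zip (replicate k a) (replicate k b)) = {(a, b)}"
        using k by (simp add: zip_replicate)
      ultimately have "(replicate k a, replicate k b) \<in> wl_aut k E"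
        using feasible_wl_aut[OF z k, of "replicate k a" "replicate k b"] by simp
      then show False using triv k that by (auto simp: replicate_eq_replicate)
    qed
    have "z {(a, a)} = 1" for a
    proof -
      have "1 = (\<Sum>b\<in>UNIV. z {(a, b)})"
        using feasibleD(1)[OF z] feasibleD(3)[OF z, of "{}" a] by simp
      also have "\<dots> = (\<Sum>b\<in>UNIV. if b = a then z {(a, a)} else 0)"
        using off by (intro sum.cong) auto
      finally show ?thesis by simp
    qed
    with off show ?thesis by (simp add: vec_eq_iff mat_def X)
  qed
  then show "aut_relaxation (k + 1) E = {mat 1}" using mat_1_in_aut_relaxation by blast
qed


section \<open>The isomorphism version\<close>

lemma distinct_nth_inj: "distinct xs \<Longrightarrow> inj_on ((!) xs) {..<length xs}"
  by (auto simp: inj_on_def nth_eq_iff_index_eq)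

text \<open>Counting smaller values describes the index without the list of cells, so that indices
  from two graphs can be compared.\<close>

lemma cell_index_ordered_level_sets:
  fixes f :: "'a \<Rightarrow> 'b::linorder"
  assumes A: "finite A" "u \<in> A"
  shows "cell_index (ordered_level_sets A f) u = card {c \<in> f ` A. c < f u}"
proof -
  define xs where "xs = sorted_list_of_set (f ` A)"
  have xs: "set xs = f ` A" "sorted_wrt (<) xs" "distinct xs"
    using A by (simp_all add: xs_def)
  from A xs(1) have "f u \<in> set xs" by simp
  then obtain i where i: "i < length xs" "xs ! i = f u" by (metis in_set_conv_nth)
  have "cell_index (ordered_level_sets A f) u = i"
    unfolding cell_index_def ordered_level_sets_def xs_def[symmetric]
  proof (rule the_equality)
    show "i < length (map (\<lambda>c. {a \<in> A. f a = c}) xs) \<and> u \<in> map (\<lambda>c. {a \<in> A. f a = c}) xs ! i"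
      using i A by simp
    fix j assume "j < length (map (\<lambda>c. {a \<in> A. f a = c}) xs) \<and> u \<in> map (\<lambda>c. {a \<in> A. f a = c}) xs ! j"
    then have "j < length xs" "xs ! j = f u" by auto
    then show "j = i" using i xs(3) by (simp add: nth_eq_iff_index_eq[symmetric])
  qed
  also have "i = card ((!) xs ` {..<i})"
    using i by (subst card_image) (auto intro: inj_on_subset[OF distinct_nth_inj[OF xs(3)]])
  also have "(!) xs ` {..<i} = {c \<in> f ` A. c < f u}"
  proof (intro equalityI subsetI)
    fix c assume "c \<in> (!) xs ` {..<i}"
    then obtain j where j: "j < i" "c = xs ! j" by auto
    with i have "xs ! j < xs ! i" by (intro sorted_wrt_nth_less[OF xs(2)]) auto
    moreover have "c \<in> set xs" using i j by simp
    ultimately show "c \<in> {c \<in> f ` A. c < f u}" using i j xs(1) by simp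
  next
    fix c assume c: "c \<in> {c \<in> f ` A. c < f u}"
    then obtain j where j: "j < length xs" "xs ! j = c"
      using xs(1) by (metis (no_types, lifting) in_set_conv_nth mem_Collect_eq)
    have "j < i"
    proof (rule ccontr)
      assume "\<not> j < i"
      then have "xs ! i \<le> xs ! j"
        using sorted_wrt_nth_less[OF xs(2), of i j] j(1) by (cases "i = j") auto
      then show False using c i j by auto
    qed
    then show "c \<in> (!) xs ` {..<i}" using j by auto
  qed
  finally show ?thesis .
qed

lemma cell_index_less_iff:
  fixes f :: "'a \<Rightarrow> 'b::linorder"
  assumes "finite A" "u \<in> A" "v \<in> A"
  shows "cell_index (ordered_level_sets A f) u < cell_index (ordered_level_sets A f) v \<longleftrightarrow> f u < f v"
proof -
  have less: "card {c \<in> f ` A. c < f u} < card {c \<in> f ` A. c < f v}"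
    if "f u < f v" "u \<in> A" for u v
  proof (intro psubset_card_mono psubsetI)
    show "{c \<in> f ` A. c < f u} \<noteq> {c \<in> f ` A. c < f v}"
      using that by blast
  qed (use assms(1) that in auto)
  have "cell_index (ordered_level_sets A f) v \<le> cell_index (ordered_level_sets A f) u"
    if "f v \<le> f u"
    unfolding cell_index_ordered_level_sets[OF assms(1,2)] cell_index_ordered_level_sets[OF assms(1,3)]
    using assms(1) that by (intro card_mono) auto
  then show ?thesis
    using less[OF _ assms(2), of v] assms
    unfolding cell_index_ordered_level_sets[OF assms(1,2)] cell_index_ordered_level_sets[OF assms(1,3)]
    by (meson linorder_not_less)
qed

lemma cell_index_eq_iff:
  fixes f :: "'a \<Rightarrow> 'b::linorder"
  assumes "finite A" "u \<in> A" "v \<in> A"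
  shows "cell_index (ordered_level_sets A f) u = cell_index (ordered_level_sets A f) v \<longleftrightarrow> f u = f v"
  using cell_index_less_iff[OF assms, of f] cell_index_less_iff[OF assms(1,3,2), of f]
  by (cases "f u" "f v" rule: linorder_cases) auto

text \<open>The index counts smaller values, so agreement at u and v is accompanied by agreement of
  the whole sets of values.\<close>

lemma cell_index_cong:
  fixes f g :: "'a \<Rightarrow> 'b::linorder"
  assumes "finite A" "u \<in> A" "v \<in> A" "f ` A = g ` A" "f u = g v"
  shows "cell_index (ordered_level_sets A f) u = cell_index (ordered_level_sets A g) v"
  using assms by (simp add: cell_index_ordered_level_sets)

text \<open>Only the order induced on A matters, not the values. The map h is the order isomorphism
  from the values of f to those of g.\<close>

lemma ordered_level_sets_cong:
  fixes f :: "'a \<Rightarrow> 'b::linorder" and g :: "'a \<Rightarrow> 'c::linorder"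
  assumes A: "finite A" and iff: "\<And>u v. u \<in> A \<Longrightarrow> v \<in> A \<Longrightarrow> f u < f v \<longleftrightarrow> g u < g v"
  shows "ordered_level_sets A f = ordered_level_sets A g"
proof -
  have eq: "f u = f v \<longleftrightarrow> g u = g v" if "u \<in> A" "v \<in> A" for u v
    using iff[OF that] iff[OF that(2,1)] by (metis less_irrefl linorder_less_linear)
  define h where "h c = g (SOME u. u \<in> A \<and> f u = c)" for c
  have h: "h (f u) = g u" if "u \<in> A" for u
  proof -
    have "(SOME v. v \<in> A \<and> f v = f u) \<in> A \<and> f (SOME v. v \<in> A \<and> f v = f u) = f u"
      using that by (intro someI[of "\<lambda>v. v \<in> A \<and> f v = f u" u]) simp
    then show ?thesis using eq that by (auto simp: h_def)
  qed
  have "sorted_list_of_set (g ` A) = map h (sorted_list_of_set (f ` A))"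
  \<comment> \<open>The mapped list is sorted and distinct, hence equal to
    \<open>sorted_list_of_set\<close> of its own set; it remains to compare sets.\<close>
  proof (rule sorted_list_of_set.idem_if_sorted_distinct[THEN subst])
    have "sorted_wrt (\<lambda>c d. h c < h d) (sorted_list_of_set (f ` A))"
    proof (rule sorted_wrt_mono_rel[of _ "(<)"])
      fix c d assume "c \<in> set (sorted_list_of_set (f ` A))" "d \<in> set (sorted_list_of_set (f ` A))" "c < d"
      then show "h c < h d" using A h iff by auto
    qed simp
    then have "sorted_wrt (<) (map h (sorted_list_of_set (f ` A)))"
      by (simp add: sorted_wrt_map)
    then show "sorted (map h (sorted_list_of_set (f ` A)))" "distinct (map h (sorted_list_of_set (f ` A)))"
      by (simp_all add: strict_sorted_iff)
    have "set (map h (sorted_list_of_set (f ` A))) = g ` A"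
      using A h by (simp add: image_image)
    then show "sorted_list_of_set (g ` A) = sorted_list_of_set (set (map h (sorted_list_of_set (f ` A))))"
      by simp
  qed
  moreover have "{a \<in> A. f a = c} = {a \<in> A. g a = h c}" if "c \<in> f ` A" for c
    using that h eq by auto
  ultimately show ?thesis
    unfolding ordered_level_sets_def using A by (auto intro!: map_cong)
qed

lemma ordered_level_sets_cell_index:
  fixes f :: "'a \<Rightarrow> 'b::linorder"
  assumes "finite A"
  shows "ordered_level_sets A (cell_index (ordered_level_sets A f)) = ordered_level_sets A f"
  by (rule ordered_level_sets_cong[OF assms]) (rule cell_index_less_iff[OF assms])

section \<open>Stages of the ordered refinement\<close>

definition wl_iso_stage :: "nat \<Rightarrow> 'n::finite set set \<Rightarrow> nat \<Rightarrow> 'n list set list" where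
  "wl_iso_stage k E n = (wl_iso_refine k ^^ n) (wl_iso_init k E)"

lemma wl_iso_stage_0: "wl_iso_stage k E 0 = ordered_level_sets (tuples k) (adj_matrix E)"
  by (simp add: wl_iso_stage_def wl_iso_init_def)

lemma wl_iso_stage_Suc:
  "wl_iso_stage k E (Suc n) = ordered_level_sets (tuples k) (wl_D (wl_iso_stage k E n))"
  by (simp add: wl_iso_stage_def wl_iso_refine_def)

lemma ordered_level_sets_cell_index_stage:
  "ordered_level_sets (tuples k) (cell_index (wl_iso_stage k E n)) = wl_iso_stage k E n"
  by (cases n) (simp_all add: wl_iso_stage_0 wl_iso_stage_Suc ordered_level_sets_cell_index finite_tuples)

text \<open>\<open>wl_D\<close> compares old indices first, so cells split but never change their
  order.\<close>

lemma wl_iso_stage_less: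
  assumes "u \<in> tuples k" "v \<in> tuples k" "cell_index (wl_iso_stage k E n) u < cell_index (wl_iso_stage k E n) v"
  shows "cell_index (wl_iso_stage k E (Suc n)) u < cell_index (wl_iso_stage k E (Suc n)) v"
  unfolding wl_iso_stage_Suc cell_index_less_iff[OF finite_tuples assms(1,2)]
  using assms(3) by (simp add: wl_D_def less_prod_def)

lemma wl_iso_stage_less_adj_matrix:
  assumes "u \<in> tuples k" "v \<in> tuples k" "adj_matrix E u < adj_matrix E v"
  shows "cell_index (wl_iso_stage k E n) u < cell_index (wl_iso_stage k E n) v"
proof (induction n)
  case 0
  show ?case unfolding wl_iso_stage_0 cell_index_less_iff[OF finite_tuples assms(1,2)] by (rule assms)
next
  case (Suc n)
  then show ?case by (rule wl_iso_stage_less[OF assms(1,2)])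
qed

text \<open>The pairs of tuples in strictly ascending cells form a growing relation, which must stop
  growing. It determines the ordered partition, so the list of cells is then stable too, not just
  the unordered partition.\<close>

lemma wl_iso_stage_stable:
  obtains n where "wl_iso_stage k E (Suc n) = wl_iso_stage k E n"
    and "\<And>m. n \<le> m \<Longrightarrow> wl_iso k E = wl_iso_stage k E m"
proof -
  let ?T = "tuples k \<times> tuples k :: ('a list \<times> 'a list) set"
  let ?S = "\<lambda>j. {(u, v) \<in> ?T. cell_index (wl_iso_stage k E j) u < cell_index (wl_iso_stage k E j) v}"
  obtain j where j: "?S (Suc j) = ?S j"
  proof (rule ascending_chain_stops[of ?T ?S])
    show "?S j \<subseteq> ?S (Suc j)" for j using wl_iso_stage_less[of _ k _ E j] by blast
  qed (auto simp: finite_tuples)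
  have "wl_iso_stage k E (Suc j) = ordered_level_sets (tuples k) (cell_index (wl_iso_stage k E (Suc j)))"
    by (rule ordered_level_sets_cell_index_stage[symmetric])
  also have "\<dots> = ordered_level_sets (tuples k) (cell_index (wl_iso_stage k E j))"
    using j by (intro ordered_level_sets_cong finite_tuples) blast
  also have "\<dots> = wl_iso_stage k E j" by (rule ordered_level_sets_cell_index_stage)
  finally have stable: "wl_iso_stage k E (Suc j) = wl_iso_stage k E j" .
  then show thesis
    using iterate_until_stable_eventually[of "wl_iso_refine k" j "wl_iso_init k E"]
    by (intro that[of j]) (simp_all add: wl_iso_def wl_iso_stage_def)
qed

lemma wl_D_eq_of_image_mset:
  assumes "length u = k" "length v = k" "cell_index \<pi> u = cell_index \<tau> v"
    and "image_mset (\<lambda>w. map (\<lambda>i. cell_index \<pi> (u[i := w])) [0..<k]) (mset_set UNIV) =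
      image_mset (\<lambda>w. map (\<lambda>i. cell_index \<tau> (v[i := w])) [0..<k]) (mset_set UNIV)"
  shows "wl_D \<pi> u = wl_D \<tau> v"
  using assms by (simp add: wl_D_def wl_omegas_def wl_omega_def[abs_def])

lemma image_mset_of_wl_D_eq:
  assumes "wl_D \<pi> u = wl_D \<tau> v"
  shows "image_mset (wl_omega \<pi> u) (mset_set UNIV) = image_mset (wl_omega \<tau> v) (mset_set UNIV)"
  using assms unfolding wl_D_def wl_omegas_def by (metis Pair_inject mset_sorted_list_of_multiset)

text \<open>Colours agree stage by stage as in the automorphism version. For the cell indices to
  agree as well, both graphs must realise the same set of colours; \<open>image\<close> takes this
  from the doubly stochastic matrix on k-tuples.\<close>

lemma feasible_wl_iso_stage:
  fixes E F :: "'n::finite set set"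
  assumes z: "feasible k E F z" and k: "k > 1"
    and uv: "length u = k" "length v = k" "0 < z (set (zip u v))"
  shows "cell_index (wl_iso_stage k E n) u = cell_index (wl_iso_stage k F n) v"
    and "wl_D (wl_iso_stage k E n) u = wl_D (wl_iso_stage k F n) v"
proof -
  have image: "f ` tuples k = g ` tuples k"
    if "\<And>u v. length u = k \<Longrightarrow> length v = k \<Longrightarrow> 0 < z (set (zip u v)) \<Longrightarrow> f u = g v"
    for f g :: "'n list \<Rightarrow> 'c"
  proof -
    have "image_mset f (mset_set (tuples k)) = image_mset g (mset_set (tuples k))"
      using that by (intro feasible_tuples_image_mset[OF z]) (auto simp: tuples_def)
    then have "set_mset (image_mset f (mset_set (tuples k))) = set_mset (image_mset g (mset_set (tuples k)))"
      by simp
    then show ?thesis by (simp add: finite_tuples)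
  qed
  have D: "wl_D \<pi> u = wl_D \<tau> v"
    if "\<And>u v. length u = k \<Longrightarrow> length v = k \<Longrightarrow> 0 < z (set (zip u v)) \<Longrightarrow> cell_index \<pi> u = cell_index \<tau> v"
      and uv: "length u = k" "length v = k" "0 < z (set (zip u v))" for \<pi> \<tau> u v
    by (rule wl_D_eq_of_image_mset[OF uv(1,2) that(1)[OF uv]])
      (rule feasible_refine_colours[OF z uv that(1)])
  have idx: "cell_index (wl_iso_stage k E n) u = cell_index (wl_iso_stage k F n) v"
    if "length u = k" "length v = k" "0 < z (set (zip u v))" for u v
    using that
  proof (induction n arbitrary: u v)
    case 0
    have "adj_matrix E ` tuples k = adj_matrix F ` tuples k"
      using feasible_adj_matrix[OF z] k by (intro image) simp
    with 0 show ?case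
      unfolding wl_iso_stage_0 using feasible_adj_matrix[OF z _ 0] k
      by (intro cell_index_cong finite_tuples) (auto simp: tuples_def)
  next
    case (Suc n)
    have "wl_D (wl_iso_stage k E n) ` tuples k = wl_D (wl_iso_stage k F n) ` tuples k"
      by (intro image D Suc.IH)
    moreover have "wl_D (wl_iso_stage k E n) u = wl_D (wl_iso_stage k F n) v"
      by (rule D[OF _ Suc.prems]) (rule Suc.IH)
    ultimately show ?case
      unfolding wl_iso_stage_Suc using Suc.prems
      by (intro cell_index_cong finite_tuples) (simp_all add: tuples_def)
  qed
  show "cell_index (wl_iso_stage k E n) u = cell_index (wl_iso_stage k F n) v"
    by (rule idx[OF uv])
  show "wl_D (wl_iso_stage k E n) u = wl_D (wl_iso_stage k F n) v"
    by (rule D[OF _ uv]) (rule idx)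
qed

section \<open>The bijections (a) and (b) on tuples\<close>

lemma bij_betw_tuples_of_feasible:
  fixes f g :: "'n::finite list \<Rightarrow> 'c"
  assumes "feasible k E F z"
    and "\<And>u v. length u = k \<Longrightarrow> length v = k \<Longrightarrow> 0 < z (set (zip u v)) \<Longrightarrow> f u = g v"
  shows "\<exists>\<gamma>. bij_betw \<gamma> (tuples k) (tuples k) \<and> (\<forall>u\<in>tuples k. f u = g (\<gamma> u))"
proof -
  have "image_mset f (mset_set (tuples k)) = image_mset g (mset_set (tuples k))"
    using assms by (intro feasible_tuples_image_mset) (auto simp: tuples_def)
  then obtain p where "p permutes tuples k" "\<forall>u\<in>tuples k. f u = g (p u)"
    by (rule image_mset_eq_implies_permutes[OF finite_tuples])
  then show ?thesis using permutes_imp_bij by blast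
qed

lemma feasible_not_wl_determines_nonisomorphic:
  fixes E F :: "'n::finite set set"
  assumes z: "feasible k E F z" and k: "k > 1"
  shows "\<not> wl_determines_nonisomorphic k E F"
proof -
  obtain m where m: "\<And>j. m \<le> j \<Longrightarrow> wl_iso k E = wl_iso_stage k E j" by (rule wl_iso_stage_stable[of k E]) blast
  obtain m' where m': "\<And>j. m' \<le> j \<Longrightarrow> wl_iso k F = wl_iso_stage k F j"
    by (rule wl_iso_stage_stable[of k F]) blast
  \<comment> \<open>A common stage at which both refinements are stable.\<close>
  have E: "wl_iso k E = wl_iso_stage k E (max m m')" and F: "wl_iso k F = wl_iso_stage k F (max m m')"
    by (auto intro: m m')
  have "\<exists>\<gamma>. bij_betw \<gamma> (tuples k) (tuples k) \<and> (\<forall>u\<in>tuples k. wl_D (wl_iso k E) u = wl_D (wl_iso k F) (\<gamma> u))"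
    unfolding E F by (intro bij_betw_tuples_of_feasible[OF z] feasible_wl_iso_stage(2)[OF z k])
  moreover have "\<exists>\<gamma>. bij_betw \<gamma> (tuples k) (tuples k) \<and> (\<forall>u\<in>tuples k. adj_matrix E u = adj_matrix F (\<gamma> u))"
    using k by (intro bij_betw_tuples_of_feasible[OF z] feasible_adj_matrix[OF z]) auto
  ultimately show ?thesis unfolding wl_determines_nonisomorphic_def by blast
qed

text \<open>Both \<open>{u. a u \<le> x}\<close> and \<open>{u. b u \<le> x}\<close> are initial segments with respect to \<open>c\<close> of the
  same size.\<close>

lemma eq_of_image_mset_eq_monotone:
  fixes a b :: "'a \<Rightarrow> 'b::linorder" and c :: "'a \<Rightarrow> 'c::linorder"
  assumes A: "finite A" and mset: "image_mset a (mset_set A) = image_mset b (mset_set A)"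
    and mono: "\<And>u v. u \<in> A \<Longrightarrow> v \<in> A \<Longrightarrow> c u \<le> c v \<Longrightarrow> a u \<le> a v"
      "\<And>u v. u \<in> A \<Longrightarrow> v \<in> A \<Longrightarrow> c u \<le> c v \<Longrightarrow> b u \<le> b v"
    and u: "u \<in> A"
  shows "a u = b u"
proof -
  have down: "{u \<in> A. a u \<le> x} = {u \<in> A. b u \<le> x}" for x
  proof -
    obtain p where p: "p permutes A" "\<forall>u\<in>A. a u = b (p u)"
      by (rule image_mset_eq_implies_permutes[OF A mset])
    have "p ` {u \<in> A. a u \<le> x} = {u \<in> A. b u \<le> x}"
    proof (intro equalityI subsetI)
      fix v assume "v \<in> {u \<in> A. b u \<le> x}"
      moreover obtain w where "w \<in> A" "v = p w"
        using permutes_image[OF p(1)] calculation by blast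
      ultimately show "v \<in> p ` {u \<in> A. a u \<le> x}" using p(2) by auto
    qed (use p permutes_in_image[OF p(1)] in auto)
    then have card: "card {u \<in> A. b u \<le> x} = card {u \<in> A. a u \<le> x}"
      using card_image[OF inj_on_subset[OF permutes_inj[OF p(1)]], of "{u \<in> A. a u \<le> x}"] by simp
    have "{u \<in> A. a u \<le> x} \<subseteq> {u \<in> A. b u \<le> x} \<or> {u \<in> A. b u \<le> x} \<subseteq> {u \<in> A. a u \<le> x}"
    proof (rule ccontr)
      assume "\<not> ?thesis"
      then obtain v w where vw: "v \<in> A" "a v \<le> x" "\<not> b v \<le> x" "w \<in> A" "b w \<le> x" "\<not> a w \<le> x" by blast
      show False
      proof (cases "c v \<le> c w")
        case True
        then show False using mono(2)[of v w] vw by auto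
      next
        case False
        then have "c w \<le> c v" by simp
        then show False using mono(1)[of w v] vw by auto
      qed
    qed
    then show ?thesis
    proof
      assume "{u \<in> A. a u \<le> x} \<subseteq> {u \<in> A. b u \<le> x}"
      from card_subset_eq[OF _ this card[symmetric]] show ?thesis using A by simp
    next
      assume "{u \<in> A. b u \<le> x} \<subseteq> {u \<in> A. a u \<le> x}"
      from card_subset_eq[OF _ this card] show ?thesis using A by simp
    qed
  qed
  have "u \<in> {v \<in> A. a v \<le> a u}" "u \<in> {v \<in> A. b v \<le> b u}" using u by simp_all
  then have "u \<in> {v \<in> A. b v \<le> a u}" "u \<in> {v \<in> A. a v \<le> b u}"
    by (simp_all only: down[of "a u"] down[of "b u"])
  then show ?thesis by simp
qed

text \<open>Tuples with the same final cell number form a bisimulation. Its bijections come from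
  equality of the lists \<open>wl_omegas\<close>; adjacency is the harder part, since (b) does not
  mention it.\<close>

lemma wl_equiv_nonempty:
  fixes E F :: "'n::finite set set"
  assumes "\<not> wl_determines_nonisomorphic k E F"
  shows "wl_equiv k E F \<noteq> {}"
proof -
  obtain \<gamma>\<^sub>0 where \<gamma>\<^sub>0: "bij_betw \<gamma>\<^sub>0 (tuples k) (tuples k)"
      "\<And>u. u \<in> tuples k \<Longrightarrow> adj_matrix E u = adj_matrix F (\<gamma>\<^sub>0 u)"
    using assms unfolding wl_determines_nonisomorphic_def by blast
  obtain \<gamma> where \<gamma>: "bij_betw \<gamma> (tuples k) (tuples k)"
      "\<And>u. u \<in> tuples k \<Longrightarrow> wl_D (wl_iso k E) u = wl_D (wl_iso k F) (\<gamma> u)"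
    using assms unfolding wl_determines_nonisomorphic_def by blast
  obtain m where m: "wl_iso_stage k E (Suc m) = wl_iso_stage k E m" "wl_iso k E = wl_iso_stage k E m"
    by (rule wl_iso_stage_stable[of k E]) blast
  obtain m' where m': "wl_iso k F = wl_iso_stage k F m'"
    by (rule wl_iso_stage_stable[of k F]) blast
  let ?c = "cell_index (wl_iso k E)" and ?d = "cell_index (wl_iso k F)"
  have cd: "?c u = ?d (\<gamma> u)" if "u \<in> tuples k" for u
    using \<gamma>(2)[OF that] by (simp add: wl_D_def)
  have \<gamma>_in: "\<gamma> u \<in> tuples k" if "u \<in> tuples k" for u
    using \<gamma>(1) that by (auto simp: bij_betw_def)
  \<comment> \<open>At the stable stage the cell index is the one computed from \<open>wl_D\<close>
    of that same partition, so equal indices give equal \<open>wl_D\<close>.\<close>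
  have stable: "wl_D (wl_iso k E) u = wl_D (wl_iso k E) v \<and> adj_matrix E u = adj_matrix E v"
    if "u \<in> tuples k" "v \<in> tuples k" "?c u = ?c v" for u v
  proof
    show "wl_D (wl_iso k E) u = wl_D (wl_iso k E) v"
      using that cell_index_eq_iff[OF finite_tuples that(1,2), of "wl_D (wl_iso k E)"] m
      by (simp add: wl_iso_stage_Suc)
    show "adj_matrix E u = adj_matrix E v"
      using wl_iso_stage_less_adj_matrix[OF that(1,2), of E m] wl_iso_stage_less_adj_matrix[OF that(2,1), of E m]
        that(3) m(2) by (metis less_irrefl linorder_less_linear)
  qed
  \<comment> \<open>Both sides are nondecreasing in the cell index, because refinement preserves the
    order of the adjacency classes, and (a) gives them the same multiset of values.\<close>
  have adj: "adj_matrix E u = adj_matrix F (\<gamma> u)" if "u \<in> tuples k" for u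
  proof (rule eq_of_image_mset_eq_monotone[OF finite_tuples _ _ _ that, where c = ?c])
    have "image_mset (adj_matrix F) (image_mset \<gamma> (mset_set (tuples k))) =
        image_mset (adj_matrix F) (image_mset \<gamma>\<^sub>0 (mset_set (tuples k)))"
      using \<gamma>(1) \<gamma>\<^sub>0(1) by (simp add: bij_betw_def image_mset_mset_set)
    also have "\<dots> = image_mset (adj_matrix E) (mset_set (tuples k))"
      using \<gamma>\<^sub>0(2) by (auto simp: finite_tuples multiset.map_comp comp_def intro!: image_mset_cong)
    finally show "image_mset (adj_matrix E) (mset_set (tuples k)) =
        image_mset (\<lambda>u. adj_matrix F (\<gamma> u)) (mset_set (tuples k))"
      by (simp add: multiset.map_comp comp_def)
  next
    fix u v :: "'n list" assume "u \<in> tuples k" "v \<in> tuples k" "?c u \<le> ?c v"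
    then show "adj_matrix E u \<le> adj_matrix E v"
      using wl_iso_stage_less_adj_matrix[of v k u E m] m(2) by (metis not_le)
  next
    fix u v :: "'n list" assume "u \<in> tuples k" "v \<in> tuples k" "?c u \<le> ?c v"
    then show "adj_matrix F (\<gamma> u) \<le> adj_matrix F (\<gamma> v)"
      using wl_iso_stage_less_adj_matrix[of "\<gamma> v" k "\<gamma> u" F m'] m' cd \<gamma>_in by (metis not_le)
  qed
  let ?R = "{(u, v). u \<in> tuples k \<and> v \<in> tuples k \<and> ?c u = ?d v}"
  have bisim: "wl_bisim k E F ?R"
    unfolding wl_bisim_def
  proof clarify
    fix u v assume uv: "u \<in> tuples k" "v \<in> tuples k" "?c u = ?d v"
    \<comment> \<open>\<gamma> need not send u to v, but it sends some u' in the same cell as u to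
      v, and stability passes from u' to u.\<close>
    obtain u' where u': "u' \<in> tuples k" "v = \<gamma> u'"
      using \<gamma>(1) uv(2) by (auto simp: bij_betw_def)
    then have "?c u = ?c u'" using cd uv(3) by simp
    from stable[OF uv(1) u'(1) this] have "wl_D (wl_iso k E) u = wl_D (wl_iso k F) v" "adj_matrix E u = adj_matrix F v"
      using \<gamma>(2) adj u' by auto
    moreover obtain \<psi> where \<psi>: "bij \<psi>" "\<And>w. wl_omega (wl_iso k E) u w = wl_omega (wl_iso k F) v (\<psi> w)"
      using bij_of_image_mset_eq[OF image_mset_of_wl_D_eq[OF calculation(1)]] by blast
    have "(u[i := w], v[i := \<psi> w]) \<in> ?R" if "i < k" for i w
      using \<psi>(2)[of w] uv that by (auto simp: wl_omega_def tuples_def map_eq_conv)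
    ultimately show "length u = k \<and> length v = k \<and> adj_matrix E u = adj_matrix F v \<and>
        (\<exists>\<psi>. bij \<psi> \<and> (\<forall>i<k. \<forall>w. (u[i := w], v[i := \<psi> w]) \<in> ?R))"
      using \<psi>(1) uv(1,2) by (auto simp: tuples_def)
  qed
  have "(replicate k undefined, \<gamma> (replicate k undefined)) \<in> ?R"
    using cd \<gamma>_in by (simp add: tuples_def)
  from subsetD[OF wl_equiv_upper[OF bisim] this] show ?thesis by auto
qed

lemma iso_relaxation_iff_wl:
  fixes E F :: "'n::finite set set"
  assumes k: "k > 1" and sg: "simple_graph E" "simple_graph F"
  shows "iso_relaxation (k + 1) E F = {} \<longleftrightarrow> wl_determines_nonisomorphic k E F"
proof
  assume empty: "iso_relaxation (k + 1) E F = {}"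
  show "wl_determines_nonisomorphic k E F"
  proof (rule ccontr)
    assume "\<not> wl_determines_nonisomorphic k E F"
    from wl_equiv_nonempty[OF this] obtain z where "feasible k E F z"
      by (rule feasible_of_wl_equiv[OF k _ sg])
    then have "(\<chi> a b. z {(a, b)}) \<in> iso_relaxation (k + 1) E F"
      unfolding Suc_eq_plus1[symmetric] iso_relaxation_iff_feasible
      by (intro exI[of _ z]) simp
    with empty show False by blast
  qed
next
  assume "wl_determines_nonisomorphic k E F"
  then have "\<not> feasible k E F z" for z
    using feasible_not_wl_determines_nonisomorphic[OF _ k] by blast
  then show "iso_relaxation (k + 1) E F = {}"
    unfolding Suc_eq_plus1[symmetric] set_eq_iff iso_relaxation_iff_feasible by simp
qed

theorem theorem1p2:
  fixes E\<^sub>G E\<^sub>H :: "'n::finite set set" and k :: nat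
  assumes "k > 1" and "simple_graph E\<^sub>G" and "simple_graph E\<^sub>H"
  shows "(aut_relaxation (k + 1) E\<^sub>G = {mat 1} \<longleftrightarrow> wl_determines_asymmetric k E\<^sub>G) \<and>
         (iso_relaxation (k + 1) E\<^sub>G E\<^sub>H = {} \<longleftrightarrow> wl_determines_nonisomorphic k E\<^sub>G E\<^sub>H)"
  using aut_relaxation_iff_wl[OF assms(1,2)] iso_relaxation_iff_wl[OF assms] by simp

end
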